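(* Let $p$ be a prime, $q$ a power of $p$, and $\mathcal{P}_1$ the set of monic irreducible polynomials in $\mathbb{F}_q[T]$. For every positive integer $k$ with $k \equiv 0 \pmod{q-1}$, the sum \[ \sum_{P \in \mathcal{P}_1} G_p(1/P^k) \] (taken in $\widehat{\mathcal{K}}$) lies in $\mathcal{K}=\mathbb{F}_q(T)$.
   Context: $G_p(U) \in \mathbb{F}_p(U)$ is the rational function $\dfrac{(1-U^p)-(1-U)^p}{p\,(1-U)^p}$, where the numerator polynomial in $\mathbb{Z}[U]$ is divided by $p$ in $\mathbb{Z}[U]$ (its coefficients are divisible by $p$) before reducing modulo $p$. (For $p=2$, $G_2(U)=U/(1-U)$.) $\mathcal{K}=\mathbb{F}_q(T)$, $\widehat{\mathcal{K}} = \mathbb{F}_q((T^{-1}))$ is its $T^{-1}$-adic completion; $G_p(1/P^k)$ is the element of $\widehat{\mathcal{K}}$ obtained by substituting $U = 1/P^k$, and the infinite sum is understood in the $T^{-1}$-adic topology. *)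

theory Defs
  imports
    "HOL-Analysis.Analysis"
    "HOL-Computational_Algebra.Computational_Algebra"
    "HOL-Number_Theory.Cong"
begin

text \<open>
  The completion \<open>F\<^sub>q((T\<^sup>-\<^sup>1))\<close> is the type \<^typ>\<open>'a fls\<close> of formal Laurent series over
  \<open>'a = F\<^sub>q\<close>, where the series variable \<^term>\<open>fls_X\<close> plays the role of \<open>T\<^sup>-\<^sup>1\<close>;
  thus \<open>T\<close> is \<^term>\<open>fls_X_inv\<close>. The library metric on \<^typ>\<open>'a fls\<close> (\<open>dist a b = 2 powi -v\<close>
  with \<open>v\<close> the subdegree of \<open>a - b\<close>) then induces the \<open>T\<^sup>-\<^sup>1\<close>-adic topology.
\<close>

definition poly_to_completion :: "'a::field poly \<Rightarrow> 'a fls" where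
  "poly_to_completion f = poly (map_poly fls_const f) fls_X_inv"

text \<open>The image of \<open>F\<^sub>q(T)\<close> in its completion.\<close>

definition rational_functions :: "'a::field fls set" where
  "rational_functions = {poly_to_completion f / poly_to_completion g | f g. g \<noteq> 0}"

definition monic_irreducibles :: "'a::field poly set" where
  "monic_irreducibles = {P. lead_coeff P = 1 \<and> irreducible P}"

text \<open>
  The polynomial \<open>((1 - U\<^sup>p) - (1 - U)\<^sup>p) / p\<close> in \<open>Z[U]\<close>; the division is exact
  for prime \<open>p\<close>, see \<open>smult_G_num\<close> below.
\<close>

definition G_num :: "nat \<Rightarrow> int poly" where
  "G_num p = ((1 - [:0, 1:] ^ p) - (1 - [:0, 1:]) ^ p) div [:int p:]"

text \<open>
  The value \<open>G\<^sub>p(u)\<close> for \<open>u\<close> in a field of characteristic \<open>p\<close>: mapping the coefficients by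
  \<^const>\<open>of_int\<close> is the reduction modulo \<open>p\<close>. It is meaningful only for \<open>u \<noteq> 1\<close>.
\<close>

definition G :: "nat \<Rightarrow> 'b::field \<Rightarrow> 'b" where
  "G p u = poly (map_poly of_int (G_num p)) u / (1 - u) ^ p"

lemma prime_dvd_one_minus_power:
  fixes x :: "'b::comm_ring_1"
  assumes p: "prime p"
  shows "of_nat p dvd (1 - x ^ p) - (1 - x) ^ p"
proof -
  have p0: "p > 0" using p prime_gt_0_nat by blast
  have "(1 - x) ^ p = (- x + 1) ^ p" by simp
  also have "\<dots> = (\<Sum>k\<le>p. of_nat (p choose k) * (- x) ^ k * 1 ^ (p - k))"
    by (rule binomial_ring)
  also have "\<dots> = (\<Sum>k\<le>p. of_nat (p choose k) * (- x) ^ k)" by simp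
  also have "{..p} = insert 0 (insert p {0<..<p})" using p0 by auto
  also have "(\<Sum>k\<in>\<dots>. of_nat (p choose k) * (- x) ^ k) =
      1 + ((- x) ^ p + (\<Sum>k\<in>{0<..<p}. of_nat (p choose k) * (- x) ^ k))"
    using p0 by simp
  finally have eq: "(1 - x ^ p) - (1 - x) ^ p = (- (x ^ p) - (- x) ^ p)
      - (\<Sum>k\<in>{0<..<p}. of_nat (p choose k) * (- x) ^ k)" by (simp add: algebra_simps)
  have "of_nat p dvd (\<Sum>k\<in>{0<..<p}. of_nat (p choose k) * (- x) ^ k)"
  proof (intro dvd_sum dvd_mult2)
    fix k assume "k \<in> {0<..<p}"
    hence "p dvd (p choose k)" using p by (intro dvd_choose_prime) auto
    then obtain c where "p choose k = p * c" by blast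
    thus "(of_nat p :: 'b) dvd of_nat (p choose k)" by simp
  qed
  moreover have "of_nat p dvd - (x ^ p) - (- x) ^ p"
  proof (cases "p = 2")
    case True
    have "- (x ^ p) - (- x) ^ p = of_nat p * (- (x ^ 2))"
      unfolding True by simp
    thus ?thesis by (metis dvd_triv_left)
  next
    case False
    hence "odd p" using p prime_odd_nat prime_ge_2_nat[OF p] by auto
    thus ?thesis by simp
  qed
  ultimately show ?thesis unfolding eq by (rule dvd_diff[rotated])
qed

lemma G_num_dvd:
  assumes "prime p"
  shows "[:int p:] dvd (1 - [:0, 1:] ^ p) - (1 - [:0, 1:]) ^ p"
  using prime_dvd_one_minus_power[OF assms, of "[:0, 1:] :: int poly"] by (simp only: of_nat_poly)

lemma smult_G_num:
  assumes "prime p"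
  shows "smult (int p) (G_num p) = (1 - [:0, 1:] ^ p) - (1 - [:0, 1:]) ^ p"
  using dvd_mult_div_cancel[OF G_num_dvd[OF assms]] by (simp add: G_num_def)

end

theory Submission
  imports Defs "HOL-Library.Poly_Mapping"
begin

unbundle no vec_syntax
notation fls_nth (infixl "$$" 75)

text \<open>
  For a finite family \<open>x\<close> put \<open>M(x) = ((\<Sum>x)\<^sup>p - \<Sum>x\<^sup>p) / p\<close>, an integral symmetric polynomial.
  In characteristic \<open>p\<close> the quotient \<open>M(x) / \<Sum>x\<^sup>p\<close> is additive on products of families, and for the
  geometric series of \<open>u\<close> it equals \<open>G\<^sub>p(u)\<close>. Unique factorization therefore identifies the sum over the
  primes with \<open>M(x) / \<Sum>x\<^sup>p\<close> for the family \<open>x = (A\<^sup>-\<^sup>k)\<close> indexed by the monic \<open>A\<close>.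

  Let \<open>k = (q - 1) k'\<close>. The elementary symmetric functions of \<open>A\<^sup>-\<^sup>(\<^sup>q\<^sup>-\<^sup>1\<^sup>)\<close> are the coefficients of
  the Carlitz exponential, whose functional equation \<open>e(T z) = T (e(z) - c e(z)\<^sup>q)\<close> shows that the one of
  degree \<open>m\<close> is a rational multiple of \<open>c\<^sup>m\<close>. Both \<open>M(x)\<close> and \<open>\<Sum>x\<^sup>p\<close> are isobaric integer
  polynomials of weight \<open>p k'\<close> in them, so that the transcendental factor cancels in the quotient.
  That \<open>M\<close> is such a polynomial is read off the factorization \<open>\<Prod>(1 - y w) = \<Prod>(1 - a\<^sub>m w\<^sup>m)\<close>,
  because the power sums of \<open>y\<close> are \<open>\<Sum>\<^bsub>m | n\<^esub> m a\<^sub>m\<^bsup>n/m\<^esup>\<close>.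
\<close>

section \<open>Lifting to a torsion-free ring\<close>

text \<open>
  Identities obtained by dividing by \<open>p\<close> hold in every commutative ring: prove them in the ring below,
  where \<open>p\<close> can be cancelled, and apply the surjective homomorphism \<open>eval_lift\<close>.
\<close>

type_synonym 'b lift = "'b multiset \<Rightarrow>\<^sub>0 int"

definition eval_lift :: "('b::comm_ring_1) lift \<Rightarrow> 'b" where
  "eval_lift f = (\<Sum>m\<in>Poly_Mapping.keys f. of_int (Poly_Mapping.lookup f m) * prod_mset m)"

lemma eval_lift_superset:
  assumes "finite A" "Poly_Mapping.keys f \<subseteq> A"
  shows "eval_lift f = (\<Sum>m\<in>A. of_int (Poly_Mapping.lookup f m) * prod_mset m)"
  unfolding eval_lift_def using assms
  by (intro sum.mono_neutral_left) (auto simp: Poly_Mapping.in_keys_iff)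

lemma eval_lift_0 [simp]: "eval_lift 0 = 0"
  by (simp add: eval_lift_def)

lemma eval_lift_add [simp]: "eval_lift (f + g) = eval_lift f + eval_lift g"
proof -
  let ?A = "Poly_Mapping.keys f \<union> Poly_Mapping.keys g"
  have "eval_lift (f + g) = (\<Sum>m\<in>?A. of_int (Poly_Mapping.lookup (f + g) m) * prod_mset m)"
    using Poly_Mapping.keys_add[of f g] by (intro eval_lift_superset) auto
  also have "\<dots> = (\<Sum>m\<in>?A. of_int (Poly_Mapping.lookup f m) * prod_mset m) + (\<Sum>m\<in>?A. of_int (Poly_Mapping.lookup g m) * prod_mset m)"
    by (simp add: Poly_Mapping.lookup_add algebra_simps sum.distrib)
  finally show ?thesis by (simp flip: eval_lift_superset)
qed

lemma eval_lift_sum [simp]: "eval_lift (sum f A) = (\<Sum>x\<in>A. eval_lift (f x))"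
  by (induction A rule: infinite_finite_induct) auto

lemma eval_lift_single [simp]: "eval_lift (Poly_Mapping.single m c) = of_int c * prod_mset m"
  by (cases "c = 0") (auto simp: eval_lift_def)

lemma eval_lift_1 [simp]: "eval_lift 1 = 1"
  by (simp flip: single_one)

lemma lift_sum_singles: "(f :: 'b lift) = (\<Sum>m\<in>Poly_Mapping.keys f. Poly_Mapping.single m (Poly_Mapping.lookup f m))"
  by (rule poly_mapping_eqI) (auto simp: Poly_Mapping.lookup_sum Poly_Mapping.lookup_single when_def Poly_Mapping.in_keys_iff)

lemma eval_lift_mult [simp]: "eval_lift (f * g) = eval_lift f * eval_lift g"
proof -
  have "f * g = (\<Sum>m\<in>Poly_Mapping.keys f. \<Sum>n\<in>Poly_Mapping.keys g. Poly_Mapping.single (m + n) (Poly_Mapping.lookup f m * Poly_Mapping.lookup g n))"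
    by (subst (1) lift_sum_singles[of f], subst (1) lift_sum_singles[of g])
      (simp add: sum_product mult_single)
  thus ?thesis
    by (simp add: eval_lift_def[of f] eval_lift_def[of g] sum_product mult_ac)
qed

lemma eval_lift_uminus [simp]: "eval_lift (- f) = - eval_lift f"
  using eval_lift_add[of f "- f"] by (simp add: eq_neg_iff_add_eq_0 add.commute del: eval_lift_add)

lemma eval_lift_diff [simp]: "eval_lift (f - g) = eval_lift f - eval_lift g"
  using eval_lift_add[of f "- g"] by (simp del: eval_lift_add)

lemma eval_lift_power [simp]: "eval_lift (f ^ n) = eval_lift f ^ n"
  by (induction n) auto

lemma eval_lift_of_nat [simp]: "eval_lift (of_nat n) = of_nat n"
  by (induction n) auto

lemma eval_lift_of_int [simp]: "eval_lift (of_int n) = of_int n"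
  by (cases n rule: int_cases2) auto

lemma eval_lift_sum_list [simp]: "eval_lift (sum_list xs) = sum_list (map eval_lift xs)"
  by (induction xs) auto

text \<open>Multisets serve as monomials, so \<open>'b lift\<close> is the polynomial ring over the
  integers with one variable for each element of \<open>'b\<close>. This is the variable belonging
  to \<open>x\<close>, which \<open>eval_lift\<close> sends back to \<open>x\<close>.\<close>

definition lift_gen :: "'b \<Rightarrow> 'b lift" where
  "lift_gen x = Poly_Mapping.single {#x#} 1"

lemma eval_lift_lift_gen [simp]: "eval_lift (lift_gen x) = x"
  by (simp add: lift_gen_def)

lemma map_eval_lift_lift_gen [simp]: "map eval_lift (map lift_gen xs) = xs"
  by (simp add: comp_def)

text \<open>Multiplication by \<open>of_nat p\<close> multiplies every integer coefficient by
  \<open>p\<close>, and the integers have no torsion.\<close>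

lemma lift_of_nat_cancel:
  assumes "of_nat p * f = of_nat p * (g :: 'b lift)" "p > 0"
  shows "f = g"
proof (rule poly_mapping_eqI)
  fix m
  have *: "Poly_Mapping.lookup (of_nat p * h) m = int p * Poly_Mapping.lookup h m" for h :: "'b lift"
    by (induction p) (simp_all add: algebra_simps Poly_Mapping.lookup_add)
  show "Poly_Mapping.lookup f m = Poly_Mapping.lookup g m"
    using assms(2) arg_cong[OF assms(1), of "\<lambda>h. Poly_Mapping.lookup h m"] by (simp add: *)
qed

section \<open>Fermat quotients of sums\<close>

text \<open>This is ((x + y)^p - x^p - y^p) / p with the division performed on the binomial
  coefficients, where it is exact for prime \<open>p\<close>; it therefore survives in
  characteristic \<open>p\<close>. Up to sign it is the carry in the addition of Witt vectors of
  length two.\<close>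

definition carry :: "nat \<Rightarrow> 'b \<Rightarrow> 'b \<Rightarrow> 'b::comm_ring_1" where
  "carry p x y = (\<Sum>i\<in>{0<..<p}. of_nat ((p choose i) div p) * x ^ i * y ^ (p - i))"

lemma of_nat_mult_carry:
  assumes p: "prime p"
  shows "of_nat p * carry p x y = (x + y) ^ p - x ^ p - y ^ p"
proof -
  have p0: "p > 0" using p prime_gt_0_nat by blast
  have "(x + y) ^ p = (\<Sum>i\<le>p. of_nat (p choose i) * x ^ i * y ^ (p - i))"
    by (rule binomial_ring)
  also have "{..p} = insert 0 (insert p {0<..<p})" using p0 by auto
  also have "(\<Sum>i\<in>\<dots>. of_nat (p choose i) * x ^ i * y ^ (p - i)) =
      y ^ p + (x ^ p + (\<Sum>i\<in>{0<..<p}. of_nat (p choose i) * x ^ i * y ^ (p - i)))"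
    using p0 by simp
  also have "(\<Sum>i\<in>{0<..<p}. of_nat (p choose i) * x ^ i * y ^ (p - i)) = of_nat p * carry p x y"
    unfolding carry_def sum_distrib_left
  proof (rule sum.cong)
    fix i assume "i \<in> {0<..<p}"
    hence "p dvd (p choose i)" using p by (intro dvd_choose_prime) auto
    then obtain c where "p choose i = p * c" by blast
    thus "of_nat (p choose i) * x ^ i * y ^ (p - i) =
        of_nat p * (of_nat ((p choose i) div p) * x ^ i * y ^ (p - i))"
      using p0 by (simp add: mult_ac)
  qed auto
  finally show ?thesis by (simp add: algebra_simps)
qed

lemma eval_lift_carry [simp]: "eval_lift (carry p x y) = carry p (eval_lift x) (eval_lift y)"
  by (simp add: carry_def)

text \<open>\<open>fermat p xs\<close> is \<open>((\<Sum>xs)\<^sup>p - \<Sum>xs\<^sup>p) / p\<close>, computed without division.\<close>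

fun fermat :: "nat \<Rightarrow> 'b list \<Rightarrow> 'b::comm_ring_1" where
  "fermat p [] = 0"
| "fermat p (x # xs) = fermat p xs + carry p x (sum_list xs)"

lemma of_nat_mult_fermat:
  assumes p: "prime p"
  shows "of_nat p * fermat p xs = sum_list xs ^ p - (\<Sum>x\<leftarrow>xs. x ^ p)"
  by (induction xs) (use p prime_gt_0_nat[OF p] in \<open>auto simp: algebra_simps of_nat_mult_carry power_0_left\<close>)

lemma eval_lift_fermat: "eval_lift (fermat p xs) = fermat p (map eval_lift xs)"
  by (induction xs) auto

text \<open>The recursion follows the order of the list, but \<open>p\<close> times its value is
  symmetric in the entries, and in the lift \<open>p\<close> can be cancelled.\<close>

lemma fermat_mset_cong:
  assumes p: "prime p" and "mset xs = mset ys"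
  shows "fermat p xs = fermat p ys"
proof -
  have *: "mset (map lift_gen xs) = mset (map lift_gen ys)" using assms(2) by simp
  have "fermat p (map lift_gen xs) = fermat p (map lift_gen ys)"
  proof (rule lift_of_nat_cancel)
    have "sum_list (map lift_gen xs) = sum_list (map lift_gen ys)" using * by (metis sum_mset_sum_list)
    moreover have "(\<Sum>x\<leftarrow>map lift_gen xs. x ^ p) = (\<Sum>x\<leftarrow>map lift_gen ys. x ^ p)"
      using assms(2) by (metis * mset_map sum_mset_sum_list)
    ultimately show "of_nat p * fermat p (map lift_gen xs) = of_nat p * fermat p (map lift_gen ys)"
      by (simp only: of_nat_mult_fermat[OF p])
  qed (use p prime_gt_0_nat in auto)
  from arg_cong[OF this, of eval_lift] show ?thesis
    by (simp only: eval_lift_fermat map_eval_lift_lift_gen)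
qed

lemma fermat_append:
  assumes p: "prime p"
  shows "fermat p (xs @ ys) = fermat p xs + fermat p ys + carry p (sum_list xs) (sum_list ys)"
proof -
  let ?X = "map lift_gen xs" and ?Y = "map lift_gen ys"
  have "fermat p (?X @ ?Y) = fermat p ?X + fermat p ?Y + carry p (sum_list ?X) (sum_list ?Y)"
    by (rule lift_of_nat_cancel[of p])
      (use p prime_gt_0_nat in \<open>simp_all add: ring_distribs of_nat_mult_fermat of_nat_mult_carry\<close>)
  from arg_cong[OF this, of eval_lift] show ?thesis
    by (simp only: eval_lift_fermat map_eval_lift_lift_gen map_append eval_lift_add eval_lift_carry eval_lift_sum_list)
qed

lemma sum_list_concat: "sum_list (concat xss) = sum_list (map sum_list xss)"
  by (induction xss) auto

text \<open>With S, T the sums and S', T' the sums of p-th powers of the two families, S^p T^p - S'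
  T' = (S^p - S') T^p + S' (T^p - T').\<close>

lemma fermat_product_aux:
  assumes p: "prime p"
  shows "of_nat p * fermat p (concat (map (\<lambda>x. map ((*) x) ys) xs)) =
    of_nat p * (fermat p xs * sum_list ys ^ p + (\<Sum>x\<leftarrow>xs. x ^ p) * fermat p ys)"
proof -
  have 1: "sum_list (concat (map (\<lambda>x. map ((*) x) ys) xs)) = sum_list xs * sum_list ys"
    by (induction xs) (auto simp: algebra_simps sum_list_const_mult)
  have 2: "(\<Sum>z\<leftarrow>concat (map (\<lambda>x. map ((*) x) ys) xs). z ^ p) = (\<Sum>x\<leftarrow>xs. x ^ p) * (\<Sum>y\<leftarrow>ys. y ^ p)"
    by (induction xs) (auto simp: algebra_simps sum_list_const_mult comp_def power_mult_distrib)
  have "of_nat p * (fermat p xs * sum_list ys ^ p + (\<Sum>x\<leftarrow>xs. x ^ p) * fermat p ys) =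
    (of_nat p * fermat p xs) * sum_list ys ^ p + (\<Sum>x\<leftarrow>xs. x ^ p) * (of_nat p * fermat p ys)"
    by (simp add: algebra_simps)
  thus ?thesis
    unfolding of_nat_mult_fermat[OF p] 1 2 by (simp add: algebra_simps power_mult_distrib)
qed

lemma fermat_product:
  assumes p: "prime p"
  shows "fermat p (concat (map (\<lambda>x. map ((*) x) ys) xs)) =
    fermat p xs * sum_list ys ^ p + (\<Sum>x\<leftarrow>xs. x ^ p) * fermat p ys"
proof -
  let ?X = "map lift_gen xs" and ?Y = "map lift_gen ys"
  have "fermat p (concat (map (\<lambda>x. map ((*) x) ?Y) ?X)) =
    fermat p ?X * sum_list ?Y ^ p + (\<Sum>x\<leftarrow>?X. x ^ p) * fermat p ?Y"
    by (rule lift_of_nat_cancel[OF fermat_product_aux[OF p]]) (use p prime_gt_0_nat in auto)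
  from arg_cong[OF this, of eval_lift] show ?thesis
    by (simp add: eval_lift_fermat map_concat comp_def)
qed

section \<open>The numerator of G_p and geometric progressions\<close>

definition G_poly :: "nat \<Rightarrow> 'b \<Rightarrow> 'b::comm_ring_1" where
  "G_poly p x = poly (map_poly of_int (G_num p)) x"

lemma poly_of_int_pCons:
  "poly (map_poly of_int (pCons a f)) x = of_int a + x * poly (map_poly of_int f) (x :: 'b::comm_ring_1)"
  by (cases "a = 0 \<and> f = 0") (auto simp: map_poly_pCons)

lemma poly_of_int_add:
  "poly (map_poly of_int (f + g)) x =
    poly (map_poly of_int f) x + poly (map_poly of_int g) (x :: 'b::comm_ring_1)"
proof -
  have "map_poly (of_int :: int \<Rightarrow> 'b) (f + g) = map_poly of_int f + map_poly of_int g"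
    by (rule poly_eqI) (simp add: coeff_map_poly)
  thus ?thesis by simp
qed

lemma poly_of_int_smult:
  "poly (map_poly of_int (smult c f)) x = of_int c * poly (map_poly of_int f) (x :: 'b::comm_ring_1)"
  by (induction f) (simp_all add: poly_of_int_pCons algebra_simps)

lemma poly_of_int_diff:
  "poly (map_poly of_int (f - g)) x =
    poly (map_poly of_int f) x - poly (map_poly of_int g) (x :: 'b::comm_ring_1)"
  using poly_of_int_add[of "f - g" g x] by simp

lemma poly_of_int_mult:
  "poly (map_poly of_int (f * g)) x =
    poly (map_poly of_int f) x * poly (map_poly of_int g) (x :: 'b::comm_ring_1)"
  by (induction f) (simp_all add: poly_of_int_pCons poly_of_int_add poly_of_int_smult algebra_simps)

lemma poly_of_int_power:
  "poly (map_poly of_int (f ^ n)) x = poly (map_poly of_int f) (x :: 'b::comm_ring_1) ^ n"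
  by (induction n) (simp_all add: poly_of_int_mult map_poly_pCons map_poly_1)

lemma of_nat_mult_G_poly:
  assumes "prime p"
  shows "of_nat p * G_poly p x = (1 - x ^ p) - (1 - x) ^ p"
proof -
  have "of_nat p * G_poly p x = poly (map_poly of_int (smult (int p) (G_num p))) x"
    by (simp add: G_poly_def poly_of_int_smult)
  also have "\<dots> = (1 - x ^ p) - (1 - x) ^ p"
    unfolding smult_G_num[OF assms]
    by (simp add: poly_of_int_diff poly_of_int_power poly_of_int_pCons map_poly_1)
  finally show ?thesis .
qed

text \<open>\<open>G_poly\<close> keeps only the numerator of \<open>G\<close>, so it makes sense in
  the lift, which is not a field, and identities about it can be transferred.\<close>

lemma eval_lift_G_poly [simp]: "eval_lift (G_poly p x) = G_poly p (eval_lift x)"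
proof -
  have "eval_lift (poly (map_poly of_int f) x) = poly (map_poly of_int f) (eval_lift x)" for f
    by (induction f) (simp_all add: poly_of_int_pCons)
  thus ?thesis by (simp add: G_poly_def)
qed

abbreviation geometric :: "'b::comm_ring_1 \<Rightarrow> nat \<Rightarrow> 'b list" where
  "geometric x J \<equiv> map (\<lambda>j. x ^ j) [0..<J]"

lemma sum_list_geometric: "(1 - x) * (\<Sum>j\<leftarrow>[0..<J]. x ^ j) = 1 - (x :: 'b::comm_ring_1) ^ J"
proof (induction J)
  case (Suc J)
  thus ?case by (simp add: distrib_left) (simp add: algebra_simps)
qed simp

lemma fermat_geometric_aux:
  fixes x :: "'b::comm_ring_1"
  assumes p: "prime p"
  shows "of_nat p * (fermat p (geometric x J) * (1 - x) ^ p * (1 - x ^ p)) =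
    of_nat p * (G_poly p x * (1 - x ^ (p * J)) - G_poly p (x ^ J) * (1 - x ^ p))"
proof -
  have 1: "(1 - x) ^ p * sum_list (geometric x J) ^ p = (1 - x ^ J) ^ p"
    using sum_list_geometric[of x J] by (metis power_mult_distrib)
  have 2: "(1 - x ^ p) * (\<Sum>y\<leftarrow>geometric x J. y ^ p) = 1 - x ^ (p * J)"
    using sum_list_geometric[of "x ^ p" J] by (simp add: comp_def mult.commute flip: power_mult)
  have "of_nat p * (fermat p (geometric x J) * (1 - x) ^ p * (1 - x ^ p)) =
    (of_nat p * fermat p (geometric x J)) * (1 - x) ^ p * (1 - x ^ p)" by (simp only: mult_ac)
  also have "\<dots> = (1 - x) ^ p * sum_list (geometric x J) ^ p * (1 - x ^ p) -
     (1 - x) ^ p * ((1 - x ^ p) * (\<Sum>y\<leftarrow>geometric x J. y ^ p))"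
    unfolding of_nat_mult_fermat[OF p] by (simp add: algebra_simps)
  also have "\<dots> = (1 - x ^ J) ^ p * (1 - x ^ p) - (1 - x) ^ p * (1 - x ^ (p * J))"
    unfolding 1 2 by simp
  \<comment> \<open>Add and subtract (1 - x^p) (1 - x^(p J)).\<close>
  also have "\<dots> = (of_nat p * G_poly p x) * (1 - x ^ (p * J)) - (of_nat p * G_poly p (x ^ J)) * (1 - x ^ p)"
    unfolding of_nat_mult_G_poly[OF p] by (simp add: algebra_simps flip: power_mult power_add)
  finally show ?thesis by (simp add: algebra_simps)
qed

text \<open>For a Laurent series \<open>x\<close> of positive valuation the term with
  \<open>x ^ J\<close> becomes negligible as \<open>J\<close> grows, so the quotient of
  \<open>fermat\<close> by the sum of p-th powers tends to \<open>G p x\<close>.\<close>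

lemma fermat_geometric:
  fixes x :: "'b::comm_ring_1"
  assumes p: "prime p"
  shows "fermat p (geometric x J) * (1 - x) ^ p * (1 - x ^ p) =
    G_poly p x * (1 - x ^ (p * J)) - G_poly p (x ^ J) * (1 - x ^ p)"
proof -
  from lift_of_nat_cancel[OF fermat_geometric_aux[OF p, where x = "lift_gen x"]] prime_gt_0_nat[OF p]
  have "fermat p (geometric (lift_gen x) J) * (1 - lift_gen x) ^ p * (1 - lift_gen x ^ p) =
    G_poly p (lift_gen x) * (1 - lift_gen x ^ (p * J)) - G_poly p (lift_gen x ^ J) * (1 - lift_gen x ^ p)" by blast
  from arg_cong[OF this, of eval_lift] show ?thesis
    by (simp add: eval_lift_fermat comp_def)
qed

section \<open>Symmetric functions and Witt coordinates\<close>

text \<open>\<open>L\<close> stands for -X E'/E, multiplied out to avoid an inverse. With this sign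
  the product of the factors 1 - y X has the generating function of the power sums of the y as its
  \<open>L\<close>.\<close>

definition is_log_deriv :: "'b::comm_ring_1 fps \<Rightarrow> 'b fps \<Rightarrow> bool" where
  "is_log_deriv E L \<longleftrightarrow> fps_X * fps_deriv E = - (L * E)"

lemma is_log_deriv_one: "is_log_deriv 1 0"
  by (simp add: is_log_deriv_def)

lemma is_log_deriv_mult:
  assumes "is_log_deriv E L" "is_log_deriv E' L'"
  shows "is_log_deriv (E * E') (L + L')"
proof -
  have "fps_X * fps_deriv (E * E') = (fps_X * fps_deriv E) * E' + E * (fps_X * fps_deriv E')"
    by (simp add: algebra_simps)
  also have "\<dots> = - ((L + L') * (E * E'))"
    using assms unfolding is_log_deriv_def by (simp add: algebra_simps)
  finally show ?thesis unfolding is_log_deriv_def .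
qed

lemma fps_mult_one_minus_monom_nth:
  fixes f :: "'b::comm_ring_1 fps"
  shows "(f * (1 - fps_const a * fps_X ^ m)) $ n = f $ n - (if n < m then 0 else f $ (n - m) * a)"
proof -
  have "f * (1 - fps_const a * fps_X ^ m) = f - fps_const a * (f * fps_X ^ m)"
    by (simp add: algebra_simps)
  thus ?thesis by (simp add: fps_X_power_mult_right_nth mult.commute)
qed

text \<open>The expansion of -X E'/E for E = 1 - a X^m, namely the sum of m a^j X^(m j) over j \<ge>
  1.\<close>

definition log_deriv_monom :: "nat \<Rightarrow> 'b::comm_ring_1 \<Rightarrow> 'b fps" where
  "log_deriv_monom m a = Abs_fps (\<lambda>n. if n > 0 \<and> m dvd n then of_nat m * a ^ (n div m) else 0)"

lemma is_log_deriv_one_minus_monom: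
  assumes "m > 0"
  shows "is_log_deriv (1 - fps_const a * fps_X ^ m) (log_deriv_monom m a)"
  unfolding is_log_deriv_def
proof (rule fps_ext)
  fix n
  have lhs: "(fps_X * fps_deriv (1 - fps_const a * fps_X ^ m)) $ n = (if n = m then - (of_nat m * a) else 0)"
    using assms by (cases n) (auto simp: fps_X_power_nth)
  have "(log_deriv_monom m a * (1 - fps_const a * fps_X ^ m)) $ n = (if n = m then of_nat m * a else 0)"
  proof (cases "n > m \<and> m dvd n")
    case True
    then obtain j where j: "n = m * j" by auto
    with True assms have "j > 1" by auto
    then obtain i where i: "j = Suc (Suc i)" by (metis One_nat_def less_imp_Suc_add plus_1_eq_Suc add_Suc)
    have "(n - m) div m = Suc i" "n div m = Suc (Suc i)" "m dvd n - m" "n - m > 0" "\<not> n < m"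
      using assms True by (auto simp: i j)
    thus ?thesis using True
      unfolding fps_mult_one_minus_monom_nth by (simp add: log_deriv_monom_def mult_ac)
  next
    case False
    then consider "n < m" | "n = m" | "n > m" "\<not> m dvd n" by linarith
    thus ?thesis
    proof cases
      case 1
      hence "\<not> (n > 0 \<and> m dvd n)" by (auto dest: dvd_imp_le)
      thus ?thesis using 1 unfolding fps_mult_one_minus_monom_nth
        by (auto simp: log_deriv_monom_def)
    next
      case 2
      thus ?thesis using assms unfolding fps_mult_one_minus_monom_nth
        by (simp add: log_deriv_monom_def)
    next
      case 3
      hence "\<not> m dvd n - m" by (simp add: dvd_minus_self)
      thus ?thesis using 3 unfolding fps_mult_one_minus_monom_nth
        by (simp add: log_deriv_monom_def)
    qed
  qed
  thus "(fps_X * fps_deriv (1 - fps_const a * fps_X ^ m)) $ n =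
      (- (log_deriv_monom m a * (1 - fps_const a * fps_X ^ m))) $ n"
    by (simp add: lhs)
qed

text \<open>Newton's identities, solved for the n-th power sum; the constant coefficient 1 of
  \<open>E\<close> makes the recursion free of division.\<close>

lemma is_log_deriv_nth:
  assumes "is_log_deriv E L" "E $ 0 = 1"
  shows "L $ n = - (of_nat n * E $ n) - (\<Sum>i<n. L $ i * E $ (n - i))"
proof -
  have "of_nat n * E $ n = (fps_X * fps_deriv E) $ n"
    by (cases n) simp_all
  also have "\<dots> = - ((L * E) $ n)"
    using assms unfolding is_log_deriv_def by simp
  also have "(L * E) $ n = (\<Sum>i<n. L $ i * E $ (n - i)) + L $ n"
    using assms(2) by (simp add: fps_mult_nth atLeast0AtMost flip: lessThan_Suc_atMost)
  finally have "of_nat n * E $ n = - ((\<Sum>i<n. L $ i * E $ (n - i)) + L $ n)" .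
  thus ?thesis by simp
qed

text \<open>Newton's recursion for index \<open>n\<close> involves only coefficients up to
  \<open>n\<close>. The truncated form allows an infinite product to be replaced by a partial
  one.\<close>

lemma is_log_deriv_unique:
  assumes "is_log_deriv E L" "is_log_deriv E' L'" "E $ 0 = 1" "\<And>i. i \<le> N \<Longrightarrow> E $ i = E' $ i" "n \<le> N"
  shows "L $ n = L' $ n"
  using \<open>n \<le> N\<close>
proof (induction n rule: less_induct)
  case (less n)
  have "E' $ 0 = 1" using assms(3,4) by (metis le0)
  thus ?case using less assms(4)
    by (subst is_log_deriv_nth[OF assms(1,3)], subst is_log_deriv_nth[OF assms(2)]) auto
qed

section \<open>Witt coordinates and their ghost components\<close>

text \<open>
  The coordinates \<open>a\<^sub>m\<close> in \<open>E = \<Prod>(1 - a\<^sub>m w\<^sup>m)\<close>, where \<open>witt_prod E n\<close> is the partial product over \<open>m \<le> n\<close>.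
\<close>

fun witt_prod :: "'b::comm_ring_1 fps \<Rightarrow> nat \<Rightarrow> 'b fps" where
  "witt_prod E 0 = 1"
| "witt_prod E (Suc n) =
    witt_prod E n * (1 - fps_const (witt_prod E n $ Suc n - E $ Suc n) * fps_X ^ Suc n)"

definition witt_coord :: "'b::comm_ring_1 fps \<Rightarrow> nat \<Rightarrow> 'b" where
  "witt_coord E n = witt_prod E (n - 1) $ n - E $ n"

lemma witt_prod_Suc:
  "witt_prod E (Suc n) = witt_prod E n * (1 - fps_const (witt_coord E (Suc n)) * fps_X ^ Suc n)"
  by (simp add: witt_coord_def)

text \<open>The factor 1 - a X^(n+1) leaves the coefficients up to n unchanged and, since the
  partial product has constant coefficient 1, lowers the next one by a; the coordinate a is chosen
  to correct exactly that coefficient.\<close>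

lemma witt_prod_nth:
  assumes "E $ 0 = 1" "i \<le> n"
  shows "witt_prod E n $ i = E $ i"
  using assms(2)
proof (induction n)
  case 0
  thus ?case using assms by simp
next
  case (Suc n)
  have 0: "witt_prod E n $ 0 = 1" for n
    by (induction n) simp_all
  show ?case
  proof (cases "i = Suc n")
    case True
    thus ?thesis using 0
      by (simp add: witt_prod_Suc fps_mult_one_minus_monom_nth witt_coord_def
        del: witt_prod.simps(2) power_Suc)
  next
    case False
    thus ?thesis using Suc
      by (simp add: witt_prod_Suc fps_mult_one_minus_monom_nth del: witt_prod.simps(2) power_Suc)
  qed
qed

lemma is_log_deriv_witt_prod:
  "is_log_deriv (witt_prod E n) (\<Sum>m\<in>{1..n}. log_deriv_monom m (witt_coord E m))"
proof (induction n)
  case (Suc n)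
  have "is_log_deriv (witt_prod E n * (1 - fps_const (witt_coord E (Suc n)) * fps_X ^ Suc n))
    ((\<Sum>m\<in>{1..n}. log_deriv_monom m (witt_coord E m)) + log_deriv_monom (Suc n) (witt_coord E (Suc n)))"
    by (intro is_log_deriv_mult Suc.IH is_log_deriv_one_minus_monom) simp
  thus ?case by (simp add: witt_prod_Suc add.commute del: witt_prod.simps(2))
qed (simp add: is_log_deriv_one)

definition root_prod :: "'b::comm_ring_1 list \<Rightarrow> 'b fps" where
  "root_prod ys = prod_list (map (\<lambda>y. 1 - fps_const y * fps_X) ys)"

lemma root_prod_simps [simp]:
  "root_prod [] = 1" "root_prod (y # ys) = (1 - fps_const y * fps_X) * root_prod ys"
  by (simp_all add: root_prod_def)

lemma root_prod_nth_0 [simp]: "root_prod ys $ 0 = 1"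
  by (induction ys) auto

lemma is_log_deriv_root_prod:
  "is_log_deriv (root_prod ys) (\<Sum>y\<leftarrow>ys. log_deriv_monom 1 y)"
proof (induction ys)
  case (Cons y ys)
  have "is_log_deriv (1 - fps_const y * fps_X ^ 1) (log_deriv_monom 1 y)"
    by (rule is_log_deriv_one_minus_monom) simp
  thus ?case using is_log_deriv_mult[OF _ Cons] by simp
qed (simp add: is_log_deriv_one)

text \<open>\<open>root_prod ys\<close> and its partial Witt product agree up to degree
  \<open>n\<close>, hence so do their logarithmic derivatives. The right-hand side is the n-th ghost
  component of the Witt coordinates.\<close>

lemma power_sum_conv_witt_coord:
  assumes "n > 0"
  shows "(\<Sum>y\<leftarrow>ys. y ^ n) =
    (\<Sum>m | m dvd n. of_nat m * witt_coord (root_prod ys) m ^ (n div m))"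
proof -
  let ?E = "root_prod ys"
  have "(\<Sum>y\<leftarrow>ys. y ^ n) = (\<Sum>y\<leftarrow>ys. log_deriv_monom 1 y) $ n"
    using assms by (induction ys) (auto simp: log_deriv_monom_def)
  also have "\<dots> = (\<Sum>m\<in>{1..n}. log_deriv_monom m (witt_coord ?E m)) $ n"
    by (rule is_log_deriv_unique[OF is_log_deriv_root_prod is_log_deriv_witt_prod, where N = n])
      (simp_all add: witt_prod_nth)
  also have "\<dots> = (\<Sum>m\<in>{1..n}. if m dvd n then of_nat m * witt_coord ?E m ^ (n div m) else 0)"
    using assms by (simp add: fps_sum_nth log_deriv_monom_def)
  also have "\<dots> = (\<Sum>m | m dvd n. of_nat m * witt_coord ?E m ^ (n div m))"
    using assms by (intro sum.mono_neutral_cong_right) (auto dest: dvd_imp_le intro: Nat.gr0I)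
  finally show ?thesis .
qed

text \<open>The integer coefficient \<open>m\<close> in the ghost component is realized by
  repetition. This presents the k-th power sum as the sum of a list to which \<open>fermat\<close>
  applies.\<close>

definition witt_list :: "'b::comm_ring_1 fps \<Rightarrow> nat \<Rightarrow> 'b list" where
  "witt_list E k = concat (map (\<lambda>m. replicate m (witt_coord E m ^ (k div m)))
     (filter (\<lambda>m. m dvd k) [1..<Suc k]))"

lemma sum_list_witt_list:
  fixes E :: "'b::comm_ring_1 fps"
  assumes "k > 0"
  shows "(\<Sum>y\<leftarrow>witt_list E k. y ^ r) = (\<Sum>m | m dvd k. of_nat m * witt_coord E m ^ (k div m * r))"
proof -
  have *: "(\<Sum>y\<leftarrow>replicate m x. y ^ r) = of_nat m * x ^ r" for m and x :: "'b"
    by (induction m) (simp_all add: algebra_simps)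
  have "(\<Sum>y\<leftarrow>witt_list E k. y ^ r) =
    (\<Sum>m\<leftarrow>filter (\<lambda>m. m dvd k) [1..<Suc k]. of_nat m * witt_coord E m ^ (k div m * r))"
    unfolding witt_list_def
    by (simp add: map_concat sum_list_concat comp_def * power_mult del: upt_Suc map_replicate)
  also have "\<dots> = (\<Sum>m\<in>set (filter (\<lambda>m. m dvd k) [1..<Suc k]). of_nat m * witt_coord E m ^ (k div m * r))"
    by (rule sum_list_distinct_conv_sum_set) simp
  also have "set (filter (\<lambda>m. m dvd k) [1..<Suc k]) = {m. m dvd k}"
    using assms by (auto dest: dvd_imp_le intro: Nat.gr0I simp: less_Suc_eq_le)
  finally show ?thesis .
qed

text \<open>Split the ghost component of index p k. The divisors m of k contribute the sum of p-th
  powers over \<open>witt_list E k\<close>. Any other divisor m of p k is a multiple of p, as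
  otherwise it would be coprime to p and divide k, so its coefficient m can be divided by p.\<close>

lemma fermat_powers_aux:
  fixes ys :: "'b::comm_ring_1 list"
  assumes p: "prime p" and k: "k > 0"
  defines "E \<equiv> root_prod ys"
  shows "of_nat p * fermat p (map (\<lambda>y. y ^ k) ys) =
    of_nat p * (fermat p (witt_list E k) -
      (\<Sum>m | m dvd p * k \<and> \<not> m dvd k. of_nat (m div p) * witt_coord E m ^ (p * k div m)))"
proof -
  have p0: "p > 0" using p prime_gt_0_nat by blast
  let ?t = "\<lambda>m. of_nat m * witt_coord E m ^ (p * k div m)"
  have fin: "finite {m. m dvd p * k}" using p0 k by (intro finite_divisors_nat) auto
  hence fin': "finite {m. m dvd k}" "finite {m. m dvd p * k \<and> \<not> m dvd k}"
    using k by (auto intro: finite_divisors_nat finite_subset)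
  have eq: "of_nat p * (of_nat (m div p) * witt_coord E m ^ (p * k div m)) = ?t m"
    if m: "m dvd p * k \<and> \<not> m dvd k" for m
  proof -
    have "p dvd m"
    proof (rule ccontr)
      assume "\<not> p dvd m"
      hence "coprime m p" using p prime_imp_coprime_nat coprime_commute by blast
      thus False using m coprime_dvd_mult_right_iff by blast
    qed
    then obtain l where "m = p * l" ..
    thus ?thesis using p0 by (simp add: mult_ac)
  qed
  have "(\<Sum>m | m dvd k. of_nat m * witt_coord E m ^ (k div m * p)) = (\<Sum>m | m dvd k. ?t m)"
    by (intro sum.cong refl) (auto simp: div_mult_swap mult.commute)
  hence 1: "(\<Sum>y\<leftarrow>witt_list E k. y ^ p) = (\<Sum>m | m dvd k. ?t m)"
    using sum_list_witt_list[OF k, where E = E and r = p] by simp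
  have 2: "sum_list (witt_list E k) = (\<Sum>y\<leftarrow>ys. y ^ k)"
    using sum_list_witt_list[OF k, where E = E and r = 1] power_sum_conv_witt_coord[OF k, of ys] by (simp add: E_def)
  have "(\<Sum>y\<leftarrow>ys. y ^ (p * k)) = (\<Sum>m | m dvd p * k. ?t m)"
    using power_sum_conv_witt_coord[of "p * k" ys] p0 k by (simp add: E_def)
  also have "\<dots> = (\<Sum>m | m dvd k. ?t m) + (\<Sum>m | m dvd p * k \<and> \<not> m dvd k. ?t m)"
    using fin' by (subst sum.union_disjoint[symmetric]) (auto intro!: sum.cong)
  also have "(\<Sum>m | m dvd p * k \<and> \<not> m dvd k. ?t m) =
      of_nat p * (\<Sum>m | m dvd p * k \<and> \<not> m dvd k. of_nat (m div p) * witt_coord E m ^ (p * k div m))"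
    unfolding sum_distrib_left by (intro sum.cong refl) (use eq in auto)
  finally have 3: "(\<Sum>y\<leftarrow>ys. y ^ (p * k)) = (\<Sum>m | m dvd k. ?t m) +
      of_nat p * (\<Sum>m | m dvd p * k \<and> \<not> m dvd k. of_nat (m div p) * witt_coord E m ^ (p * k div m))" .
  show ?thesis
    using 3 by (simp add: right_diff_distrib of_nat_mult_fermat[OF p] 1 2 comp_def
      mult.commute[of p k] flip: power_mult)
qed

definition eval_lift_fps :: "('b::comm_ring_1) lift fps \<Rightarrow> 'b fps" where
  "eval_lift_fps f = Abs_fps (\<lambda>n. eval_lift (f $ n))"

lemma eval_lift_fps_nth [simp]: "eval_lift_fps f $ n = eval_lift (f $ n)"
  by (simp add: eval_lift_fps_def)

lemma eval_lift_fps_mult_one_minus_monom: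
  "eval_lift_fps (f * (1 - fps_const a * fps_X ^ m)) =
    eval_lift_fps f * (1 - fps_const (eval_lift a) * fps_X ^ m)"
  by (rule fps_ext) (simp add: fps_mult_one_minus_monom_nth)

lemma eval_lift_fps_one [simp]: "eval_lift_fps 1 = 1"
  by (rule fps_ext) simp

lemma eval_lift_fps_root_prod: "eval_lift_fps (root_prod ys) = root_prod (map eval_lift ys)"
proof (induction ys)
  case (Cons y ys)
  thus ?case using eval_lift_fps_mult_one_minus_monom[of "root_prod ys" y 1]
    by (simp add: mult.commute)
qed simp

lemma eval_lift_fps_witt_prod: "eval_lift_fps (witt_prod E n) = witt_prod (eval_lift_fps E) n"
  by (induction n)
    (simp_all add: eval_lift_fps_mult_one_minus_monom flip: eval_lift_fps_nth del: power_Suc)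

lemma eval_lift_witt_coord: "eval_lift (witt_coord E n) = witt_coord (eval_lift_fps E) n"
  by (simp add: witt_coord_def flip: eval_lift_fps_nth eval_lift_fps_witt_prod)

text \<open>The right-hand side is an integer polynomial in the Witt coordinates, isobaric of weight
  p k when the m-th coordinate has weight m. The coordinates in turn depend only on the coefficients
  of \<open>root_prod ys\<close>.\<close>

lemma fermat_powers:
  fixes ys :: "'b::comm_ring_1 list"
  assumes p: "prime p" and k: "k > 0"
  shows "fermat p (map (\<lambda>y. y ^ k) ys) = fermat p (witt_list (root_prod ys) k) -
      (\<Sum>m | m dvd p * k \<and> \<not> m dvd k. of_nat (m div p) * witt_coord (root_prod ys) m ^ (p * k div m))"
proof -
  let ?Y = "map lift_gen ys"
  have *: "map eval_lift (witt_list (root_prod ?Y) k) = witt_list (root_prod ys) k"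
    by (simp add: witt_list_def map_concat comp_def eval_lift_witt_coord eval_lift_fps_root_prod
      del: upt_Suc)
  have "fermat p (map (\<lambda>y. y ^ k) ?Y) = fermat p (witt_list (root_prod ?Y) k) -
      (\<Sum>m | m dvd p * k \<and> \<not> m dvd k. of_nat (m div p) * witt_coord (root_prod ?Y) m ^ (p * k div m))"
    by (rule lift_of_nat_cancel[OF fermat_powers_aux[OF p k]]) (use p prime_gt_0_nat in auto)
  from arg_cong[OF this, of eval_lift] show ?thesis
    by (simp add: eval_lift_fermat comp_def eval_lift_witt_coord eval_lift_fps_root_prod *)
qed

section \<open>Valuations and the completion\<close>

text \<open>Stated by vanishing coefficients because \<open>fls_subdegree 0\<close> is 0, whereas
  the zero series has to satisfy every bound.\<close>

definition val_ge :: "int \<Rightarrow> 'a::field fls \<Rightarrow> bool" where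
  "val_ge N x \<longleftrightarrow> (\<forall>n<N. x $$ n = 0)"

lemma val_ge_conv_subdegree: "val_ge N x \<longleftrightarrow> x = 0 \<or> N \<le> fls_subdegree x"
proof
  assume "val_ge N x"
  thus "x = 0 \<or> N \<le> fls_subdegree x"
    unfolding val_ge_def by (metis fls_subdegree_geI)
qed (auto simp: val_ge_def)

lemma val_ge_0 [simp]: "val_ge N 0"
  by (simp add: val_ge_def)

lemma val_ge_0_1 [simp]: "val_ge 0 1"
  by (simp add: val_ge_conv_subdegree)

lemma val_ge_add: "val_ge N x \<Longrightarrow> val_ge N y \<Longrightarrow> val_ge N (x + y)"
  by (simp add: val_ge_def)

lemma val_ge_diff: "val_ge N x \<Longrightarrow> val_ge N y \<Longrightarrow> val_ge N (x - y)"
  by (simp add: val_ge_def)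

lemma val_ge_uminus: "val_ge N x \<Longrightarrow> val_ge N (- x)"
  by (simp add: val_ge_def)

lemma val_ge_mono: "val_ge N x \<Longrightarrow> M \<le> N \<Longrightarrow> val_ge M x"
  by (simp add: val_ge_def)

lemma val_ge_mult: "val_ge N x \<Longrightarrow> val_ge M y \<Longrightarrow> val_ge (N + M) (x * y)"
  by (cases "x = 0 \<or> y = 0") (auto simp: val_ge_conv_subdegree)

lemma val_ge_mult_left: "val_ge 0 x \<Longrightarrow> val_ge M y \<Longrightarrow> val_ge M (x * y)"
  using val_ge_mult[of 0 x M y] by simp

lemma val_ge_mult_right: "val_ge N x \<Longrightarrow> val_ge 0 y \<Longrightarrow> val_ge N (x * y)"
  using val_ge_mult[of N x 0 y] by simp

lemma val_ge_power: "val_ge N x \<Longrightarrow> val_ge (int n * N) (x ^ n)"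
proof (induction n)
  case (Suc n)
  thus ?case using val_ge_mult[of N x "int n * N" "x ^ n"] by (simp add: algebra_simps)
qed simp

lemma val_ge_power_pos: "val_ge N x \<Longrightarrow> 0 \<le> N \<Longrightarrow> n > 0 \<Longrightarrow> val_ge N (x ^ n)"
  by (erule val_ge_mono[OF val_ge_power]) (simp add: mult_le_cancel_right1)

lemma val_ge_sum: "(\<And>i. i \<in> A \<Longrightarrow> val_ge N (f i)) \<Longrightarrow> val_ge N (sum f A)"
  by (induction A rule: infinite_finite_induct) (auto intro: val_ge_add)

lemma val_ge_sum_list: "(\<And>x. x \<in> set xs \<Longrightarrow> val_ge N (f x)) \<Longrightarrow> val_ge N (\<Sum>x\<leftarrow>xs. f x)"
  by (induction xs) (auto intro: val_ge_add)

lemma val_ge_of_nat [simp]: "val_ge 0 (of_nat n)"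
  by (induction n) (auto intro: val_ge_add)

lemma val_ge_of_int [simp]: "val_ge 0 (of_int n)"
  by (cases n rule: int_cases2) (auto intro: val_ge_uminus)

lemma val_ge_divide: "val_ge N x \<Longrightarrow> y \<noteq> 0 \<Longrightarrow> val_ge (N - fls_subdegree y) (x / y)"
proof (cases "x = 0")
  case False
  assume "val_ge N x" and y: "y \<noteq> 0"
  moreover have "fls_subdegree (x / y * y) = fls_subdegree (x / y) + fls_subdegree y"
    using False y by (intro fls_subdegree_mult) auto
  ultimately show ?thesis
    using False by (auto simp: val_ge_conv_subdegree)
qed simp

text \<open>Such a series has subdegree 0, so dividing by it preserves valuation bounds. The power
  sums in the denominators below are of this kind.\<close>

lemma one_unit:
  assumes "val_ge 1 (x - 1)"
  shows "x \<noteq> 0" "fls_subdegree x = 0" "val_ge 0 x"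
proof -
  have nz: "(x - 1) $$ n = 0" if "n < 1" for n
    using assms that unfolding val_ge_def by blast
  from nz[of 0] have 0: "x $$ 0 \<noteq> 0" by simp
  thus "x \<noteq> 0" by auto
  have "x $$ n = 0" if "n < 0" for n
    using nz[of n] that by simp
  thus "fls_subdegree x = 0" using 0 by (intro fls_subdegree_eqI) auto
  thus "val_ge 0 x" by (simp add: val_ge_conv_subdegree)
qed

lemma one_unit_mult:
  assumes "val_ge 1 (x - 1)" "val_ge 1 (y - 1)"
  shows "val_ge 1 (x * y - 1)"
proof -
  have eq: "x * y - 1 = (x - 1) * y + (y - 1)" by (simp add: algebra_simps)
  show ?thesis unfolding eq using assms by (intro val_ge_add val_ge_mult_right one_unit(3))
qed

lemma one_unit_power: "val_ge 1 (x - 1) \<Longrightarrow> val_ge 1 (x ^ n - 1)"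
  by (induction n) (auto intro: one_unit_mult)

lemma val_ge_divide_one_unit:
  "val_ge N x \<Longrightarrow> val_ge 1 (y - 1) \<Longrightarrow> val_ge N (x / y)"
  using val_ge_divide[of N x y] one_unit(1,2)[of y] by simp

text \<open>Every summand contains \<open>y\<close> with a positive exponent, as i < p.\<close>

lemma val_ge_carry:
  assumes "val_ge 0 x" "val_ge N y" "N \<ge> 0"
  shows "val_ge N (carry p x y)"
  unfolding carry_def
  using assms by (intro val_ge_sum val_ge_mult_left val_ge_power_pos) (auto intro: val_ge_mult_left)

lemma val_ge_fermat:
  assumes "\<And>x. x \<in> set xs \<Longrightarrow> val_ge N x" "N \<ge> 0"
  shows "val_ge N (fermat p xs)"
  using assms
proof (induction xs)
  case (Cons x xs)
  have "val_ge N (sum_list xs)" using Cons.prems val_ge_sum_list[of xs N "\<lambda>x. x"] by simp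
  with Cons show ?case
    by (auto intro!: val_ge_add val_ge_carry intro: val_ge_mono)
qed simp

lemma dist_fls_le:
  fixes x y :: "'a::field fls"
  assumes "val_ge (int N) (x - y)"
  shows "dist x y \<le> (1 / 2) ^ N"
proof (cases "x = y")
  case False
  hence *: "int N \<le> fls_subdegree (x - y)" using assms by (auto simp: val_ge_conv_subdegree)
  hence "(1 / 2 :: real) ^ nat (fls_subdegree (x - y)) \<le> (1 / 2) ^ N"
    by (intro power_decreasing) auto
  thus ?thesis using False * by (simp add: dist_fls_def power_one_over field_simps)
qed simp

section \<open>The embedding of the polynomials\<close>

lemma poly_to_completion_0 [simp]: "poly_to_completion 0 = 0"
  by (simp add: poly_to_completion_def)

lemma poly_to_completion_pCons:
  "poly_to_completion (pCons a f) = fls_const a + fls_X_inv * poly_to_completion f"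
  by (cases "a = 0 \<and> f = 0") (auto simp: poly_to_completion_def map_poly_pCons)

lemma poly_to_completion_1 [simp]: "poly_to_completion 1 = 1"
  by (simp add: poly_to_completion_def)

lemma poly_to_completion_nth:
  "poly_to_completion f $$ n = (if n \<le> 0 then coeff f (nat (- n)) else 0)"
proof (induction f arbitrary: n)
  case (pCons a f)
  have "poly_to_completion (pCons a f) $$ n = (if n = 0 then a else 0) + poly_to_completion f $$ (n + 1)"
    by (simp add: poly_to_completion_pCons fls_X_inv_times_conv_shift)
  also have "\<dots> = (if n \<le> 0 then coeff (pCons a f) (nat (- n)) else 0)"
    unfolding pCons.IH by (auto simp: coeff_pCons nat_diff_distrib split: nat.splits intro!: arg_cong[of _ _ "coeff f"])
  finally show ?case .
qed simp

lemma poly_to_completion_add: "poly_to_completion (f + g) = poly_to_completion f + poly_to_completion g"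
  by (rule fls_eqI) (simp add: poly_to_completion_nth)

lemma poly_to_completion_uminus: "poly_to_completion (- f) = - poly_to_completion f"
  by (rule fls_eqI) (simp add: poly_to_completion_nth)

lemma poly_to_completion_diff: "poly_to_completion (f - g) = poly_to_completion f - poly_to_completion g"
  by (rule fls_eqI) (simp add: poly_to_completion_nth)

lemma poly_to_completion_smult: "poly_to_completion (smult c f) = fls_const c * poly_to_completion f"
  by (induction f) (simp_all add: poly_to_completion_pCons algebra_simps)

lemma poly_to_completion_mult: "poly_to_completion (f * g) = poly_to_completion f * poly_to_completion g"
  by (induction f) (simp_all add: poly_to_completion_pCons poly_to_completion_add poly_to_completion_smult algebra_simps)

lemma poly_to_completion_eq_iff: "poly_to_completion f = poly_to_completion g \<longleftrightarrow> f = g"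
proof
  assume eq: "poly_to_completion f = poly_to_completion g"
  show "f = g"
  proof (rule poly_eqI)
    fix n
    show "coeff f n = coeff g n"
      using arg_cong[OF eq, of "\<lambda>x. x $$ (- int n)"] by (simp add: poly_to_completion_nth)
  qed
qed auto

lemma poly_to_completion_eq_0_iff [simp]: "poly_to_completion f = 0 \<longleftrightarrow> f = 0"
  using poly_to_completion_eq_iff[of f 0] by simp

lemma fls_subdegree_poly_to_completion:
  "f \<noteq> 0 \<Longrightarrow> fls_subdegree (poly_to_completion f) = - int (degree f)"
  by (rule fls_subdegree_eqI) (auto simp: poly_to_completion_nth coeff_eq_0)

section \<open>The rational functions as a subfield\<close>

lemma poly_to_completion_in_rational_functions [intro]: "poly_to_completion f \<in> rational_functions"
  unfolding rational_functions_def by (rule CollectI, intro exI[of _ f] exI[of _ 1]) simp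

lemma rational_functions_add [intro]:
  assumes "x \<in> rational_functions" "y \<in> rational_functions"
  shows "x + y \<in> rational_functions"
proof -
  obtain f g f' g' where "x = poly_to_completion f / poly_to_completion g" "g \<noteq> 0"
    "y = poly_to_completion f' / poly_to_completion g'" "g' \<noteq> 0"
    using assms unfolding rational_functions_def by blast
  hence "x + y = poly_to_completion (f * g' + f' * g) / poly_to_completion (g * g')" "g * g' \<noteq> 0"
    by (simp_all add: poly_to_completion_mult poly_to_completion_add field_simps)
  thus ?thesis unfolding rational_functions_def by blast
qed

lemma rational_functions_mult [intro]:
  assumes "x \<in> rational_functions" "y \<in> rational_functions"
  shows "x * y \<in> rational_functions"
proof -
  obtain f g f' g' where "x = poly_to_completion f / poly_to_completion g" "g \<noteq> 0"
    "y = poly_to_completion f' / poly_to_completion g'" "g' \<noteq> 0"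
    using assms unfolding rational_functions_def by blast
  hence "x * y = poly_to_completion (f * f') / poly_to_completion (g * g')" "g * g' \<noteq> 0"
    by (simp_all add: poly_to_completion_mult)
  thus ?thesis unfolding rational_functions_def by blast
qed

lemma rational_functions_inverse [intro]:
  assumes "x \<in> rational_functions"
  shows "inverse x \<in> rational_functions"
proof -
  obtain f g where fg: "x = poly_to_completion f / poly_to_completion g" "g \<noteq> 0"
    using assms unfolding rational_functions_def by blast
  show ?thesis
  proof (cases "f = 0")
    case True
    thus ?thesis using fg poly_to_completion_in_rational_functions[of 0] by simp
  next
    case False
    moreover have "inverse x = poly_to_completion g / poly_to_completion f"
      using fg by simp
    ultimately show ?thesis unfolding rational_functions_def by blast
  qed
qed

lemma rational_functions_divide [intro]:
  "x \<in> rational_functions \<Longrightarrow> y \<in> rational_functions \<Longrightarrow> x / y \<in> rational_functions"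
  unfolding divide_inverse by blast

lemma rational_functions_0 [intro, simp]: "0 \<in> rational_functions"
  using poly_to_completion_in_rational_functions[of 0] by simp

lemma rational_functions_1 [intro, simp]: "1 \<in> rational_functions"
  using poly_to_completion_in_rational_functions[of 1] by simp

lemma rational_functions_uminus [intro]: "x \<in> rational_functions \<Longrightarrow> - x \<in> rational_functions"
  using rational_functions_mult[OF poly_to_completion_in_rational_functions[of "- 1"]]
  by (simp add: poly_to_completion_uminus)

lemma rational_functions_diff [intro]:
  "x \<in> rational_functions \<Longrightarrow> y \<in> rational_functions \<Longrightarrow> x - y \<in> rational_functions"
  using rational_functions_add[OF _ rational_functions_uminus] by fastforce

lemma rational_functions_of_nat [intro, simp]: "of_nat n \<in> rational_functions"
  by (induction n) auto

lemma fls_X_inv_in_rational_functions [intro, simp]: "fls_X_inv \<in> rational_functions"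
  using poly_to_completion_in_rational_functions[of "[:0, 1:]"]
  by (simp add: poly_to_completion_pCons flip: one_pCons)

lemma rational_functions_power [intro]: "x \<in> rational_functions \<Longrightarrow> x ^ n \<in> rational_functions"
  by (induction n) auto

section \<open>The Euler product\<close>

definition monics :: "nat \<Rightarrow> 'a::field poly set" where
  "monics d = {A. lead_coeff A = 1 \<and> degree A < d}"

text \<open>The zero polynomial is listed separately because its \<open>degree\<close> is 0; thus
  \<open>small_polys 0\<close> is {0} and \<open>small_polys d\<close> is a vector space of
  dimension \<open>d\<close>.\<close>

definition small_polys :: "nat \<Rightarrow> 'a::field poly set" where
  "small_polys d = {A. A = 0 \<or> degree A < d}"

lemma small_polys_0: "small_polys 0 = {0}"
  by (auto simp: small_polys_def)

lemma small_polys_Suc: "small_polys (Suc d) = (\<lambda>(c, A). pCons c A) ` (UNIV \<times> small_polys d)"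
proof (intro equalityI subsetI)
  fix f :: "'a poly" assume f: "f \<in> small_polys (Suc d)"
  obtain c A where fA: "f = pCons c A" by (cases f) auto
  have "A \<in> small_polys d" using f by (auto simp: fA small_polys_def split: if_splits)
  thus "f \<in> (\<lambda>(c, A). pCons c A) ` (UNIV \<times> small_polys d)" using fA by auto
qed (auto simp: small_polys_def split: if_splits)

lemma small_polys_finite_card:
  "finite (small_polys d :: 'a::{field,finite} poly set) \<and> card (small_polys d :: 'a poly set) = CARD('a) ^ d"
proof (induction d)
  case (Suc d)
  have "inj_on (\<lambda>(c, A). pCons c A) (UNIV \<times> (small_polys d :: 'a poly set))"
    by (auto simp: inj_on_def)
  thus ?case using Suc by (simp add: small_polys_Suc card_image card_cartesian_product)
qed (simp add: small_polys_0)

lemma finite_small_polys [simp]: "finite (small_polys d :: 'a::{field,finite} poly set)"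
  and card_small_polys: "card (small_polys d :: 'a poly set) = CARD('a) ^ d"
  using small_polys_finite_card[of d, where ?'a = 'a] by simp_all

lemma finite_monics [simp]: "finite (monics d :: 'a::{field,finite} poly set)"
  by (rule finite_subset[OF _ finite_small_polys[of d]])
    (auto simp: monics_def small_polys_def)

text \<open>The terms of the expanded product of 1 + P + ... + P^(J-1) over the listed
  \<open>P\<close>: a truncated Euler product.\<close>

fun exponent_box :: "'a::field poly list \<Rightarrow> nat \<Rightarrow> 'a poly list" where
  "exponent_box [] J = [1]"
| "exponent_box (P # Ps) J = concat (map (\<lambda>j. map ((*) (P ^ j)) (exponent_box Ps J)) [0..<J])"

lemma monic_irreducible_dvd_monic:
  assumes "P \<in> monic_irreducibles" "Q \<in> monic_irreducibles" "P dvd Q"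
  shows "P = (Q :: 'a::field poly)"
proof -
  from assms have "irreducible P" "irreducible Q" "lead_coeff P = 1" "lead_coeff Q = 1"
    by (auto simp: monic_irreducibles_def)
  then have "Q dvd P" using \<open>P dvd Q\<close> by (metis irreducibleD' irreducible_not_unit)
  have "P \<noteq> 0" "Q \<noteq> 0" using \<open>lead_coeff P = 1\<close> \<open>lead_coeff Q = 1\<close> by auto
  hence "degree P = degree Q"
    using \<open>P dvd Q\<close> \<open>Q dvd P\<close> by (intro antisym dvd_imp_degree_le)
  obtain R where R: "Q = P * R" using \<open>P dvd Q\<close> ..
  have "R \<noteq> 0" using R \<open>Q \<noteq> 0\<close> by auto
  hence "degree R = 0"
    using R \<open>degree P = degree Q\<close> \<open>P \<noteq> 0\<close> by (simp add: degree_mult_eq)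
  then obtain c where c: "R = [:c:]" by (rule degree_eq_zeroE)
  have "lead_coeff Q = lead_coeff P * lead_coeff R" by (simp only: R lead_coeff_mult)
  hence "c = 1" using \<open>lead_coeff P = 1\<close> \<open>lead_coeff Q = 1\<close> by (simp add: c)
  thus ?thesis using R c by simp
qed

lemma monic_irreducible_prime_elem: "P \<in> monic_irreducibles \<Longrightarrow> prime_elem (P :: 'a::field poly)"
  by (auto simp: monic_irreducibles_def intro: field_poly_irreducible_imp_prime)

lemma exponent_box_prime_dvd:
  assumes "set Ps \<subseteq> monic_irreducibles" "A \<in> set (exponent_box Ps J)"
    "Q \<in> monic_irreducibles" "Q dvd A"
  shows "Q \<in> set (Ps :: 'a::field poly list)"
  using assms
proof (induction Ps arbitrary: A)
  case Nil
  thus ?case by (auto simp: monic_irreducibles_def irreducible_not_unit)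
next
  case (Cons P Ps)
  from Cons.prems obtain j B where "A = P ^ j * B" "B \<in> set (exponent_box Ps J)" by auto
  moreover from this Cons.prems have "Q dvd P \<or> Q dvd B"
    using monic_irreducible_prime_elem[of Q] prime_elem_dvd_mult_iff prime_elem_dvd_power by blast
  ultimately show ?case
    using Cons.IH[of B] Cons.prems monic_irreducible_dvd_monic[of Q P] by auto
qed

lemma exponent_box_monic:
  assumes "set Ps \<subseteq> monic_irreducibles" "A \<in> set (exponent_box Ps J)"
  shows "lead_coeff (A :: 'a::field poly) = 1"
  using assms
proof (induction Ps arbitrary: A)
  case (Cons P Ps)
  thus ?case by (auto simp: lead_coeff_mult lead_coeff_power monic_irreducibles_def)
qed auto

lemma power_mult_cancel_prime:
  assumes "prime_elem P" "\<not> P dvd A" "\<not> P dvd B" "P ^ i * A = P ^ j * (B :: 'a::field poly)"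
  shows "i = j \<and> A = B"
proof -
  have le: "i \<le> j" if "\<not> P dvd B" "P ^ i * A = P ^ j * B" for i j and A B :: "'a poly"
  proof (rule ccontr)
    assume "\<not> i \<le> j"
    then obtain l where "i = j + Suc l" by (metis less_imp_Suc_add not_le add_Suc_right)
    with that have "P ^ j * (P * (P ^ l * A)) = P ^ j * B" by (simp add: power_add mult_ac)
    hence "P * (P ^ l * A) = B" using assms(1) by simp
    thus False using that(1) by (metis dvd_triv_left)
  qed
  have "i = j" using le[OF assms(3,4)] le[OF assms(2) assms(4)[symmetric]] by simp
  thus ?thesis using assms(1,4) by simp
qed

text \<open>Uniqueness of factorization: \<open>P\<close> divides no member of the box of the
  remaining primes, so a product P^j A determines both j and A.\<close>

lemma distinct_exponent_box:
  assumes "set Ps \<subseteq> monic_irreducibles" "distinct Ps"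
  shows "distinct (exponent_box (Ps :: 'a::field poly list) J)"
  using assms
proof (induction Ps)
  case (Cons P Ps)
  have P: "P \<in> monic_irreducibles" "prime_elem P"
    using Cons.prems monic_irreducible_prime_elem by auto
  have ndvd: "\<not> P dvd A" if "A \<in> set (exponent_box Ps J)" for A
    using exponent_box_prime_dvd[OF _ that P(1)] Cons.prems by auto
  have P0: "P \<noteq> 0" using P(2) by auto
  have "distinct (concat (map (\<lambda>j. map ((*) (P ^ j)) (exponent_box Ps J)) [0..<n]))" for n
  proof (induction n)
    case (Suc n)
    have "distinct (map ((*) (P ^ n)) (exponent_box Ps J))"
      using Cons P0 by (auto simp: distinct_map inj_on_def)
    moreover have "P ^ i * A \<noteq> P ^ n * B"
      if "i < n" "A \<in> set (exponent_box Ps J)" "B \<in> set (exponent_box Ps J)" for i A B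
      using power_mult_cancel_prime[OF P(2) ndvd ndvd, of A B i n] that by blast
    hence "set (concat (map (\<lambda>j. map ((*) (P ^ j)) (exponent_box Ps J)) [0..<n])) \<inter>
        set (map ((*) (P ^ n)) (exponent_box Ps J)) = {}"
      by fastforce
    ultimately show ?case using Suc by simp
  qed simp
  thus ?case by simp
qed simp

lemma monic_degree_0:
  assumes "lead_coeff A = 1" "degree A = 0"
  shows "A = 1"
proof -
  obtain c where "A = [:c:]" using assms(2) by (rule degree_eq_zeroE)
  thus ?thesis using assms(1) by (simp add: one_pCons)
qed

text \<open>A monic divisor of least positive degree is irreducible, since a proper factor of it
  could be made monic.\<close>

lemma monic_irreducible_factor:
  assumes "lead_coeff (A :: 'a::field poly) = 1" "A \<noteq> 1"
  shows "\<exists>P\<in>monic_irreducibles. P dvd A"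
proof -
  have normed: "\<exists>Q. lead_coeff Q = 1 \<and> Q dvd B \<and> degree Q = degree B" if "B \<noteq> 0" for B :: "'a poly"
    by (rule exI[of _ "smult (inverse (lead_coeff B)) B"]) (use that in \<open>auto simp: smult_dvd_iff\<close>)
  define S where "S = {Q. lead_coeff Q = 1 \<and> Q dvd A \<and> degree Q > 0}"
  have "A \<in> S" using assms monic_degree_0[of A] by (auto simp: S_def intro: Nat.gr0I)
  then obtain P where P: "P \<in> S" and min: "\<And>Q. Q \<in> S \<Longrightarrow> degree P \<le> degree Q"
    using ex_has_least_nat[of "\<lambda>Q. Q \<in> S" A degree] by blast
  have "irreducible P"
  proof (rule irreducibleI)
    show P0: "P \<noteq> 0" using P by (auto simp: S_def)
    show "\<not> is_unit P" using P is_unit_iff_degree[OF P0] by (simp add: S_def)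
    fix a b assume ab: "P = a * b"
    show "is_unit a \<or> is_unit b"
    proof (rule ccontr)
      assume *: "\<not> (is_unit a \<or> is_unit b)"
      have nz: "a \<noteq> 0" "b \<noteq> 0" using P ab by (auto simp: S_def)
      with * have deg: "degree a > 0" "degree b > 0" by (auto simp: is_unit_iff_degree)
      obtain Q where Q: "lead_coeff Q = 1" "Q dvd a" "degree Q = degree a"
        using normed[OF nz(1)] by blast
      have "Q dvd A" using Q(2) P ab by (auto simp: S_def intro: dvd_trans)
      with Q deg have "Q \<in> S" by (simp add: S_def)
      from min[OF this] Q(3) deg(2) nz ab show False by (simp add: degree_mult_eq)
    qed
  qed
  thus ?thesis using P by (auto simp: S_def monic_irreducibles_def)
qed

lemma exists_power_mult_not_dvd:
  assumes "(A :: 'a::field poly) \<noteq> 0" "degree P > 0"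
  shows "\<exists>j B. A = P ^ j * B \<and> \<not> P dvd B"
  using assms(1)
proof (induction "degree A" arbitrary: A rule: less_induct)
  case less
  show ?case
  proof (cases "P dvd A")
    case True
    then obtain C where C: "A = P * C" ..
    have "C \<noteq> 0" "P \<noteq> 0" using C less.prems by auto
    hence "degree C < degree A" using C assms(2) by (simp add: degree_mult_eq)
    from less.hyps[OF this \<open>C \<noteq> 0\<close>] obtain j B where "C = P ^ j * B" "\<not> P dvd B" by blast
    hence "A = P ^ Suc j * B \<and> \<not> P dvd B" by (simp add: C mult_ac)
    thus ?thesis by blast
  qed (auto intro: exI[of _ 0] exI[of _ A])
qed

text \<open>Existence of factorization: split off the full power P^j. As \<open>P\<close> has
  positive degree, j is at most the degree of \<open>A\<close> and hence below
  \<open>J\<close>.\<close>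

lemma exponent_box_complete:
  assumes "set Ps \<subseteq> monic_irreducibles" "lead_coeff A = 1" "degree A < J"
    "\<And>Q. Q \<in> monic_irreducibles \<Longrightarrow> Q dvd A \<Longrightarrow> Q \<in> set Ps"
  shows "(A :: 'a::field poly) \<in> set (exponent_box Ps J)"
  using assms
proof (induction Ps arbitrary: A)
  case Nil
  thus ?case using monic_irreducible_factor[of A] by auto
next
  case (Cons P Ps)
  have P: "P \<in> monic_irreducibles" "prime_elem P"
    using Cons.prems monic_irreducible_prime_elem by auto
  have lP: "lead_coeff P = 1" using P(1) by (simp add: monic_irreducibles_def)
  have A0: "A \<noteq> 0" using Cons.prems by auto
  have dP: "degree P > 0"
    using P(2) by (metis is_unit_iff_degree neq0_conv prime_elem_def)
  obtain j B where B: "A = P ^ j * B" "\<not> P dvd B"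
    using exists_power_mult_not_dvd[OF A0 dP] by blast
  have B0: "B \<noteq> 0" using A0 B by auto
  have deg: "degree A = j * degree P + degree B"
    using B0 A0 unfolding B by (subst degree_mult_eq) (auto simp: degree_power_eq)
  have "j * 1 \<le> j * degree P" using dP by (intro mult_le_mono2) simp
  hence "j < J" using deg Cons.prems(3) by linarith
  moreover have "B \<in> set (exponent_box Ps J)"
  proof (rule Cons.IH)
    show "lead_coeff B = 1" using Cons.prems(2) lP by (simp add: B lead_coeff_mult lead_coeff_power)
    show "degree B < J" using deg Cons.prems by simp
    show "Q \<in> set Ps" if "Q \<in> monic_irreducibles" "Q dvd B" for Q
      using Cons.prems(4)[of Q] that B by auto
  qed (use Cons.prems in auto)
  ultimately show ?case using B by auto
qed

section \<open>Fermat quotients of Euler products in characteristic p\<close>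

lemma freshmans_dream_sum_list:
  assumes "prime p" "CHAR('b::comm_semiring_1) = p"
  shows "sum_list xs ^ p = (\<Sum>x\<leftarrow>xs. x ^ p :: 'b)"
  using assms by (induction xs) (auto simp: freshmans_dream power_0_left)

text \<open>In characteristic p the p-th power of a sum is the sum of p-th powers. The Leibniz rule
  \<open>fermat_product\<close> then becomes additive after division by these sums.\<close>

lemma fermat_product_char:
  fixes xs ys :: "'b::field list"
  assumes p: "prime p" "CHAR('b) = p"
    and nz: "(\<Sum>x\<leftarrow>xs. x ^ p) \<noteq> 0" "(\<Sum>y\<leftarrow>ys. y ^ p) \<noteq> 0"
  defines "zs \<equiv> concat (map (\<lambda>x. map ((*) x) ys) xs)"
  shows "(\<Sum>z\<leftarrow>zs. z ^ p) = (\<Sum>x\<leftarrow>xs. x ^ p) * (\<Sum>y\<leftarrow>ys. y ^ p)"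
    and "fermat p zs / (\<Sum>z\<leftarrow>zs. z ^ p) =
      fermat p xs / (\<Sum>x\<leftarrow>xs. x ^ p) + fermat p ys / (\<Sum>y\<leftarrow>ys. y ^ p)"
proof -
  show 1: "(\<Sum>z\<leftarrow>zs. z ^ p) = (\<Sum>x\<leftarrow>xs. x ^ p) * (\<Sum>y\<leftarrow>ys. y ^ p)"
    unfolding zs_def
    by (induction xs) (auto simp: algebra_simps sum_list_const_mult comp_def power_mult_distrib)
  show "fermat p zs / (\<Sum>z\<leftarrow>zs. z ^ p) =
      fermat p xs / (\<Sum>x\<leftarrow>xs. x ^ p) + fermat p ys / (\<Sum>y\<leftarrow>ys. y ^ p)"
    using nz unfolding 1 unfolding zs_def fermat_product[OF p(1)] freshmans_dream_sum_list[OF p]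
    by (simp add: field_simps)
qed

lemma G_conv_G_poly: "G p x = G_poly p x / (1 - x) ^ p"
  by (simp add: G_def G_poly_def)

text \<open>The numerator polynomial vanishes at 0, because \<open>p\<close> times its value there
  is 1 - 1; hence it is a multiple of the variable.\<close>

lemma val_ge_G_poly:
  assumes "prime p" "val_ge N x" "N \<ge> 0"
  shows "val_ge N (G_poly p x)"
proof -
  have x: "val_ge 0 x" using assms val_ge_mono by blast
  have "int p * poly (G_num p) 0 = poly (smult (int p) (G_num p)) 0" by simp
  also have "\<dots> = 0" unfolding smult_G_num[OF assms(1)] using prime_gt_0_nat[OF assms(1)] by simp
  finally have "poly (G_num p) 0 = 0" using prime_gt_0_nat[OF assms(1)] by simp
  then obtain f where f: "G_num p = pCons 0 f"
    by (metis pCons_cases poly_0_coeff_0 coeff_pCons_0)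
  have "val_ge 0 (poly (map_poly of_int g) x)" for g
    by (induction g) (auto simp: poly_of_int_pCons intro!: val_ge_add val_ge_mult_left x)
  thus ?thesis using assms by (simp add: G_poly_def f poly_of_int_pCons val_ge_mult_right)
qed

lemma val_ge_G:
  assumes "prime p" "val_ge N x" "N \<ge> 1"
  shows "val_ge N (G p x)"
  unfolding G_conv_G_poly using assms
  by (intro val_ge_divide_one_unit val_ge_G_poly one_unit_power)
    (auto simp: intro: val_ge_uminus val_ge_mono)

text \<open>After division, \<open>fermat_geometric\<close> leaves an error equal to
  \<open>G_poly p (x ^ J)\<close> times a unit of the form 1 + (positive valuation).\<close>

lemma fermat_geometric_approx:
  fixes x :: "'a::field fls"
  assumes p: "prime p" "CHAR('a) = p" and x: "val_ge 1 x" and J: "J > 0"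
  shows "(\<Sum>y\<leftarrow>geometric x J. y ^ p) \<noteq> 0"
    and "val_ge (int J) (G p x - fermat p (geometric x J) / (\<Sum>y\<leftarrow>geometric x J. y ^ p))"
proof -
  have p0: "p > 0" using p prime_gt_0_nat by blast
  have unit: "val_ge 1 ((1 - x ^ n) - 1)" if "n > 0" for n
    using val_ge_uminus[OF val_ge_power_pos[OF x _ that]] by simp
  have nz: "1 - x ^ n \<noteq> 0" if "n > 0" for n using one_unit(1)[OF unit[OF that]] .
  let ?s = "\<Sum>y\<leftarrow>geometric x J. y ^ p"
  have 2: "(1 - x ^ p) * ?s = 1 - x ^ (p * J)"
    using sum_list_geometric[of "x ^ p" J] by (simp add: comp_def mult.commute flip: power_mult)
  show s0: "?s \<noteq> 0" using 2 nz[of "p * J"] p0 J by auto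
  have "fermat p (geometric x J) / ?s =
      (fermat p (geometric x J) * (1 - x) ^ p * (1 - x ^ p)) / (?s * (1 - x) ^ p * (1 - x ^ p))"
    using nz[of p] nz[of 1] p0 by simp
  also have "?s * (1 - x) ^ p * (1 - x ^ p) = (1 - x ^ (p * J)) * (1 - x) ^ p"
    unfolding 2[symmetric] by (simp add: mult_ac)
  also have "(fermat p (geometric x J) * (1 - x) ^ p * (1 - x ^ p)) / \<dots> =
      G p x - G_poly p (x ^ J) * (1 - x ^ p) / ((1 - x ^ (p * J)) * (1 - x) ^ p)"
    unfolding fermat_geometric[OF p(1)] G_conv_G_poly
    using nz[of "p * J"] nz[of 1] p0 J by (simp add: field_simps)
  finally have "G p x - fermat p (geometric x J) / ?s =
      G_poly p (x ^ J) * (1 - x ^ p) / ((1 - x ^ (p * J)) * (1 - x) ^ p)" by simp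
  moreover have "val_ge (int J) \<dots>"
  proof (intro val_ge_divide_one_unit val_ge_mult_right val_ge_G_poly one_unit_mult one_unit_power)
    show "val_ge (int J) (x ^ J)" using val_ge_power[OF x, of J] by simp
    show "val_ge 1 (1 - x - 1)" using unit[of 1] by simp
  qed (use p p0 J unit[of "p * J"] one_unit(3)[OF unit[of p]] in auto)
  ultimately show "val_ge (int J) (G p x - fermat p (geometric x J) / ?s)" by simp
qed

context
  fixes \<chi> :: "'a::field poly \<Rightarrow> 'a fls"
  assumes \<chi>_1: "\<chi> 1 = 1" and \<chi>_mult: "\<And>A B. \<chi> (A * B) = \<chi> A * \<chi> B"
    and \<chi>_val: "\<And>A. lead_coeff A = 1 \<Longrightarrow> val_ge (int (degree A)) (\<chi> A)"
begin

lemma \<chi>_power: "\<chi> (A ^ n) = \<chi> A ^ n"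
  by (induction n) (simp_all add: \<chi>_1 \<chi>_mult)

text \<open>Adjoining a prime multiplies the family by a geometric progression, so the quotient
  grows by \<open>G p\<close> of that prime up to an error of valuation at least \<open>J\<close>.
  Such errors do not accumulate, the valuation being ultrametric.\<close>

lemma fermat_exponent_box:
  assumes p: "prime p" "CHAR('a) = p" and J: "J > 0" and Ps: "set Ps \<subseteq> monic_irreducibles"
  defines "xs \<equiv> map \<chi> (exponent_box Ps J)"
  shows "(\<Sum>x\<leftarrow>xs. x ^ p) \<noteq> 0 \<and>
    val_ge (int J) ((\<Sum>P\<leftarrow>Ps. G p (\<chi> P)) - fermat p xs / (\<Sum>x\<leftarrow>xs. x ^ p))"
  using Ps unfolding xs_def
proof (induction Ps)
  case Nil
  thus ?case by (simp add: \<chi>_1 carry_def power_0_left)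
next
  case (Cons P Ps)
  define ys where "ys = map \<chi> (exponent_box Ps J)"
  have eq: "map \<chi> (exponent_box (P # Ps) J) = concat (map (\<lambda>x. map ((*) x) ys) (geometric (\<chi> P) J))"
    by (simp add: ys_def map_concat comp_def \<chi>_mult \<chi>_power)
  have "degree P > 0" "lead_coeff P = 1"
    using Cons.prems by (auto simp: monic_irreducibles_def irreducible_def is_unit_iff_degree intro: Nat.gr0I)
  hence x: "val_ge 1 (\<chi> P)" using \<chi>_val[of P] by (auto elim: val_ge_mono)
  note geo = fermat_geometric_approx[OF p x J]
  have IH: "(\<Sum>x\<leftarrow>ys. x ^ p) \<noteq> 0"
    "val_ge (int J) ((\<Sum>P\<leftarrow>Ps. G p (\<chi> P)) - fermat p ys / (\<Sum>x\<leftarrow>ys. x ^ p))"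
    using Cons by (auto simp: ys_def)
  have ch: "CHAR('a fls) = p" using p(2) by simp
  note prod = fermat_product_char[OF p(1) ch geo(1) IH(1)]
  have "val_ge (int J) ((\<Sum>P\<leftarrow>P # Ps. G p (\<chi> P)) -
     (fermat p (geometric (\<chi> P) J) / (\<Sum>x\<leftarrow>geometric (\<chi> P) J. x ^ p) +
      fermat p ys / (\<Sum>x\<leftarrow>ys. x ^ p)))"
    using val_ge_add[OF geo(2) IH(2)] by (simp add: add_diff_add)
  moreover have "(\<Sum>x\<leftarrow>map \<chi> (exponent_box (P # Ps) J). x ^ p) \<noteq> 0"
    unfolding eq prod(1) using geo(1) IH(1) by simp
  ultimately show ?case unfolding eq prod(2) by blast
qed

lemma sum_powers_one_unit:
  assumes p: "prime p" and As: "distinct As" "1 \<in> set As" "\<And>A. A \<in> set As \<Longrightarrow> lead_coeff A = 1"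
  shows "val_ge 1 ((\<Sum>A\<leftarrow>As. \<chi> A ^ p) - 1)"
proof -
  have "(\<Sum>A\<leftarrow>As. \<chi> A ^ p) = (\<Sum>A\<in>set As. \<chi> A ^ p)"
    using As(1) by (simp add: sum_list_distinct_conv_sum_set)
  also have "\<dots> = 1 + (\<Sum>A\<in>set As - {1}. \<chi> A ^ p)"
    using As(2) by (subst sum.remove[of _ 1]) (auto simp: \<chi>_1)
  finally have eq: "(\<Sum>A\<leftarrow>As. \<chi> A ^ p) - 1 = (\<Sum>A\<in>set As - {1}. \<chi> A ^ p)" by simp
  show ?thesis unfolding eq
  proof (intro val_ge_sum val_ge_power_pos)
    fix A assume "A \<in> set As - {1}"
    hence A: "lead_coeff A = 1" "A \<noteq> 1" using As(3) by auto
    hence "degree A > 0" using monic_degree_0 by blast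
    thus "val_ge 1 (\<chi> A)" using \<chi>_val[OF A(1)] by (auto elim: val_ge_mono)
  qed (use p prime_gt_0_nat in auto)
qed

lemma val_ge_0_monic: "lead_coeff A = 1 \<Longrightarrow> val_ge 0 (\<chi> A)"
  using \<chi>_val[of A] by (auto elim: val_ge_mono)

text \<open>The box over the primes of degree below d contains every monic of degree below d, and
  its other members have degree at least d. Discarding them changes numerator and denominator of the
  quotient only by terms of valuation at least d.\<close>

lemma sum_G_approx:
  assumes p: "prime p" "CHAR('a) = p" and d: "d > 0"
    and L: "distinct L" "set L = monics d"
    and Ps: "distinct Ps" "set Ps = {P \<in> monic_irreducibles. degree P < d}"
  shows "val_ge (int d) ((\<Sum>P\<leftarrow>Ps. G p (\<chi> P)) - fermat p (map \<chi> L) / (\<Sum>A\<leftarrow>L. \<chi> A ^ p))"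
    (is "val_ge _ (?S - ?M / ?s)")
proof -
  \<comment> \<open>Exponents below d suffice, as no monic of degree below d is divisible by the
    d-th power of a prime.\<close>
  define B where "B = exponent_box Ps d"
  have sub: "set Ps \<subseteq> monic_irreducibles" using Ps by auto
  have B: "distinct B" "\<And>A. A \<in> set B \<Longrightarrow> lead_coeff A = 1"
    using distinct_exponent_box[OF sub Ps(1)] exponent_box_monic[OF sub] by (auto simp: B_def)
  have LB: "set L \<subseteq> set B"
  proof
    fix A assume "A \<in> set L"
    hence A: "lead_coeff A = 1" "degree A < d" using L by (auto simp: monics_def)
    have "Q \<in> set Ps" if "Q \<in> monic_irreducibles" "Q dvd A" for Q
    proof -
      have "A \<noteq> 0" using A by auto
      hence "degree Q \<le> degree A" using that by (intro dvd_imp_degree_le)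
      thus ?thesis using that A Ps by auto
    qed
    thus "A \<in> set B" unfolding B_def using exponent_box_complete[OF sub A] by blast
  qed
  define R where "R = filter (\<lambda>A. A \<notin> set L) B"
  have ms: "mset B = mset (L @ R)"
    by (rule set_eq_iff_mset_eq_distinct[THEN iffD1]) (use B(1) L(1) LB in \<open>auto simp: R_def\<close>)
  have R: "val_ge (int d) (\<chi> A)" if "A \<in> set R" for A
  proof -
    have "lead_coeff A = 1" "degree A \<ge> d" using that B(2) L by (auto simp: R_def monics_def)
    thus ?thesis using \<chi>_val[of A] by (auto elim: val_ge_mono)
  qed
  have one: "1 \<in> set L" using d L by (auto simp: monics_def)
  let ?sB = "\<Sum>A\<leftarrow>B. \<chi> A ^ p" and ?MB = "fermat p (map \<chi> B)"
  have u: "val_ge 1 (?s - 1)" "val_ge 1 (?sB - 1)"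
    by (rule sum_powers_one_unit; use p L B LB one in \<open>auto simp: monics_def\<close>)+
  have val0: "val_ge 0 (\<chi> A)" if "A \<in> set L" for A
    using that L by (intro val_ge_0_monic) (auto simp: monics_def)
  have "fermat p (map \<chi> B) = fermat p (map \<chi> (L @ R))"
    by (rule fermat_mset_cong[OF p(1)]) (simp only: ms mset_map)
  also have "\<dots> - ?M = fermat p (map \<chi> R) + carry p (\<Sum>A\<leftarrow>L. \<chi> A) (\<Sum>A\<leftarrow>R. \<chi> A)"
    by (simp add: fermat_append[OF p(1)])
  also have "val_ge (int d) \<dots>"
    by (intro val_ge_add val_ge_fermat val_ge_carry val_ge_sum_list) (use val0 R in auto)
  finally have M: "val_ge (int d) (?MB - ?M)" .
  have "?sB = (\<Sum>A\<leftarrow>L @ R. \<chi> A ^ p)"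
    by (simp only: ms mset_map flip: sum_mset_sum_list)
  hence "?sB - ?s = (\<Sum>A\<leftarrow>R. \<chi> A ^ p)" by simp
  also have "val_ge (int d) \<dots>"
    by (intro val_ge_sum_list val_ge_power_pos R) (use p prime_gt_0_nat in auto)
  finally have s: "val_ge (int d) (?sB - ?s)" .
  have M0: "val_ge 0 ?M" by (rule val_ge_fermat) (use val0 in auto)
  have "?MB / ?sB - ?M / ?s = ((?MB - ?M) * ?s - ?M * (?sB - ?s)) / (?sB * ?s)"
    using one_unit(1)[OF u(1)] one_unit(1)[OF u(2)] by (simp add: field_simps)
  moreover have "val_ge (int d) ((?MB - ?M) * ?s - ?M * (?sB - ?s))"
    using val_ge_mult_right[OF M one_unit(3)[OF u(1)]] val_ge_mult_left[OF M0 s] by (rule val_ge_diff)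
  hence "val_ge (int d) (((?MB - ?M) * ?s - ?M * (?sB - ?s)) / (?sB * ?s))"
    by (rule val_ge_divide_one_unit) (rule one_unit_mult[OF u(2) u(1)])
  ultimately have "val_ge (int d) (?MB / ?sB - ?M / ?s)" by simp
  moreover have "val_ge (int d) (?S - ?MB / ?sB)"
    using fermat_exponent_box[OF p d sub] by (simp add: B_def comp_def)
  ultimately show ?thesis using val_ge_add by fastforce
qed

end

section \<open>The Carlitz exponential\<close>

lemma card_UNIV_field_ge_2: "CARD('a::{field,finite}) \<ge> 2"
  using card_mono[of UNIV "{0, 1 :: 'a}"] by simp

lemma field_power_card_minus_one:
  fixes c :: "'a::{field,finite}"
  assumes "c \<noteq> 0"
  shows "c ^ (CARD('a) - 1) = 1"
proof -
  have "(\<Prod>y\<in>UNIV-{0}. c * y) = (\<Prod>y\<in>UNIV-{0}. y)"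
    by (rule prod.reindex_bij_witness[of _ "\<lambda>y. y / c" "\<lambda>y. c * y"]) (use assms in auto)
  moreover have "(\<Prod>y\<in>UNIV-{0}. c * y) = c ^ (CARD('a) - 1) * (\<Prod>y\<in>UNIV-{0}. y)"
    by (simp add: prod.distrib)
  ultimately show ?thesis by simp
qed

text \<open>The translation y + 1 permutes the field; comparing the sums over all elements shows
  that the cardinality is 0 in the field.\<close>

lemma CHAR_finite_field:
  assumes "prime p" "CARD('a::{field,finite}) = p ^ n"
  shows "CHAR('a) = p"
proof -
  have "prime CHAR('a)"
    using prime_CHAR_semidom[where ?'a = 'a] finite_imp_CHAR_pos[where ?'a = 'a] by simp
  moreover have "(\<Sum>y\<in>UNIV. y + 1) = (\<Sum>y\<in>UNIV. y :: 'a)"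
    by (rule sum.reindex_bij_witness[of _ "\<lambda>y. y - 1" "\<lambda>y. y + 1"]) auto
  hence "of_nat CARD('a) = (0 :: 'a)" by (simp add: sum.distrib)
  hence "CHAR('a) dvd p ^ n" unfolding assms(2) by (simp only: of_nat_eq_0_iff_char_dvd)
  ultimately show ?thesis
    using assms(1) by (metis prime_dvd_power primes_dvd_imp_eq)
qed

text \<open>The q-th power map is additive, so it acts on each monomial separately.\<close>

lemma coeff_power_CHAR_power:
  fixes f :: "'b::field poly"
  assumes p: "prime CHAR('b)" and q: "q = CHAR('b) ^ n"
  shows "coeff (f ^ q) i = (if q dvd i then coeff f (i div q) ^ q else 0)"
proof -
  have q0: "q > 0" using p q prime_gt_0_nat by simp
  have "f ^ q = (\<Sum>j\<le>degree f. monom (coeff f j) j) ^ q"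
    by (simp add: poly_as_sum_of_monoms)
  also have "\<dots> = (\<Sum>j\<le>degree f. monom (coeff f j) j ^ q)"
    by (rule freshmans_dream_sum') (use p q in simp_all)
  finally have "coeff (f ^ q) i = (\<Sum>j\<le>degree f. if q * j = i then coeff f j ^ q else 0)"
    by (simp add: coeff_sum monom_power mult.commute)
  also have "\<dots> = (if q dvd i then coeff f (i div q) ^ q else 0)"
  proof (cases "q dvd i")
    case True
    then obtain l where l: "i = q * l" ..
    have "(\<Sum>j\<le>degree f. if q * j = i then coeff f j ^ q else 0) =
        (\<Sum>j\<le>degree f. if j = l then coeff f j ^ q else 0)"
      using q0 by (intro sum.cong) (auto simp: l)
    also have "\<dots> = coeff f l ^ q"
      using q0 by (auto simp: coeff_eq_0 not_le)
    finally show ?thesis using q0 l by simp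
  qed (auto intro!: sum.neutral)
  finally show ?thesis .
qed

section \<open>Polynomials determined by their zeros\<close>

lemma coeff_pcompose_linear: "coeff (pcompose f [:0, t :: 'b::comm_ring_1:]) n = t ^ n * coeff f (n :: nat)"
proof (induction f arbitrary: n)
  case (pCons a f)
  thus ?case by (cases n) (simp_all add: pcompose_pCons algebra_simps)
qed simp

lemma coeff_pcompose_monom:
  assumes "s > 0"
  shows "coeff (pcompose f (monom (1 :: 'b::comm_ring_1) s)) (s * m) = coeff f (m :: nat)"
proof (induction f arbitrary: m)
  case (pCons a f)
  thus ?case using assms
    by (cases m) (simp_all add: pcompose_pCons coeff_monom_mult coeff_pCons split: nat.splits)
qed simp

lemma degree_prod_linear: "degree (\<Prod>w\<in>W. [:- w, 1 :: 'b::field:]) = card W"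
  by (subst degree_prod_eq_sum_degree) auto

lemma monic_prod_linear: "coeff (\<Prod>w\<in>W. [:- w, 1 :: 'b::field:]) (card W) = 1"
  using lead_coeff_prod[of "\<lambda>w. [:- w, 1 :: 'b:]" W] by (simp add: degree_prod_linear)

lemma poly_conv_prod_roots:
  fixes f :: "'b::field poly"
  assumes "finite W" "degree f \<le> card W" "\<And>w. w \<in> W \<Longrightarrow> poly f w = 0"
  shows "f = smult (coeff f (card W)) (\<Prod>w\<in>W. [:- w, 1:])"
proof (rule poly_eqI_degree_lead_coeff[of _ "card W" _ W])
  fix z assume z: "z \<in> W"
  hence "(\<Prod>w\<in>W. z - w) = 0" using assms(1) by (intro prod_zero) auto
  thus "poly f z = poly (smult (coeff f (card W)) (\<Prod>w\<in>W. [:- w, 1:])) z"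
    using assms(3)[OF z] by (simp add: poly_prod)
qed (use assms in \<open>auto simp: monic_prod_linear degree_prod_linear\<close>)

text \<open>The difference is a scalar multiple of the product over \<open>W\<close>. This product
  has a simple zero at 0, so its linear coefficient is nonzero and equality of the linear
  coefficients forces the scalar to be 0.\<close>

lemma poly_eqI_roots_coeff_1:
  fixes f g :: "'b::field poly"
  assumes W: "finite W" "0 \<in> W" and deg: "degree f \<le> card W" "degree g \<le> card W"
    and roots: "\<And>w. w \<in> W \<Longrightarrow> poly f w = 0" "\<And>w. w \<in> W \<Longrightarrow> poly g w = 0"
    and eq: "coeff f 1 = coeff g 1"
  shows "f = g"
proof -
  let ?F = "\<Prod>w\<in>W. [:- w, 1:]"
  define a where "a = coeff (f - g) (card W)"
  have fg: "f - g = smult a ?F"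
    unfolding a_def using W deg roots by (intro poly_conv_prod_roots degree_diff_le) auto
  have "?F = [:0, 1:] * (\<Prod>w\<in>W - {0}. [:- w, 1:])"
    using W by (subst prod.remove[of W 0]) auto
  hence "coeff ?F 1 = poly (\<Prod>w\<in>W - {0}. [:- w, 1:]) 0"
    by (simp add: poly_0_coeff_0)
  also have "\<dots> \<noteq> 0" using W by (simp add: poly_prod)
  finally have "coeff ?F 1 \<noteq> 0" .
  moreover have "a * coeff ?F 1 = 0" using arg_cong[OF fg, of "\<lambda>h. coeff h 1"] eq by simp
  ultimately have "a = 0" by simp
  thus ?thesis using fg by simp
qed

section \<open>The Carlitz polynomials, their zeros and their functional equation\<close>

definition carlitz_root :: "'a::{field,finite} poly \<Rightarrow> 'a fls" where
  "carlitz_root A = 1 / poly_to_completion A ^ (CARD('a) - 1)"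

text \<open>The coefficients are, up to sign, the elementary symmetric functions of the
  \<open>carlitz_root A\<close>.\<close>

definition carlitz_E :: "nat \<Rightarrow> 'a::{field,finite} fls poly" where
  "carlitz_E d = (\<Prod>A\<in>monics d. [:1, - carlitz_root A:])"

text \<open>
  The polynomial \<open>z \<Prod>(1 - z / A)\<close> over the nonzero \<open>A\<close> of degree less than \<open>d\<close>, with the factors of
  the scalar multiples of each monic \<open>A\<close> combined into \<open>1 - (z / A)\<^bsup>q - 1\<^esup>\<close>.
\<close>

definition carlitz_exp :: "nat \<Rightarrow> 'a::{field,finite} fls poly" where
  "carlitz_exp d = [:0, 1:] * pcompose (carlitz_E d) (monom 1 (CARD('a) - 1))"

lemma poly_carlitz_exp:
  "poly (carlitz_exp d) z = z * poly (carlitz_E d) (z ^ (CARD('a) - 1))" for z :: "'a::{field,finite} fls"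
  by (simp add: carlitz_exp_def poly_pcompose poly_monom)

lemma coeff_carlitz_exp:
  "coeff (carlitz_exp d :: 'a::{field,finite} fls poly) (Suc ((CARD('a) - 1) * m)) = coeff (carlitz_E d) m"
  using card_UNIV_field_ge_2[where ?'a = 'a]
  by (simp add: carlitz_exp_def coeff_pcompose_monom)

lemma coeff_carlitz_E_0: "coeff (carlitz_E d) 0 = 1"
  by (simp add: carlitz_E_def poly_prod flip: poly_0_coeff_0)

lemma coeff_carlitz_exp_1: "coeff (carlitz_exp d :: 'a::{field,finite} fls poly) 1 = 1"
  using coeff_carlitz_exp[of d 0, where ?'a = 'a] by (simp add: coeff_carlitz_E_0)

lemma coeff_carlitz_exp_0 [simp]: "coeff (carlitz_exp d) 0 = 0"
  by (simp add: carlitz_exp_def)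

text \<open>Scaling maps pairs of a nonzero constant and a monic injectively to nonzero polynomials
  of degree below \<open>d\<close>. The inequality serves to bound the degree of
  \<open>carlitz_exp\<close>.\<close>

lemma card_monics_le:
  "Suc ((CARD('a) - 1) * card (monics d :: 'a::{field,finite} poly set)) \<le> CARD('a) ^ d"
proof -
  have "inj_on (\<lambda>(c, A). smult c A) ((UNIV - {0}) \<times> (monics d :: 'a poly set))"
  proof (rule inj_onI)
    fix x y assume xy: "x \<in> (UNIV - {0}) \<times> (monics d :: 'a poly set)"
      "y \<in> (UNIV - {0}) \<times> (monics d :: 'a poly set)"
      "(\<lambda>(c, A). smult c A) x = (\<lambda>(c, A). smult c A) y"
    obtain c A c' A' where [simp]: "x = (c, A)" "y = (c', A')" by (cases x; cases y) auto
    have *: "lead_coeff A = 1" "lead_coeff A' = 1" "c \<noteq> 0" "smult c A = smult c' A'"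
      using xy by (auto simp: monics_def)
    have c: "c = c'"
      using arg_cong[OF *(4), of lead_coeff] unfolding lead_coeff_smult *(1,2) by simp
    hence "smult (inverse c) (smult c A) = smult (inverse c) (smult c A')" using *(4) by simp
    thus "x = y" using *(3) c by simp
  qed
  moreover have "(\<lambda>(c, A). smult c A) ` ((UNIV - {0}) \<times> monics d) \<subseteq> (small_polys d - {0} :: 'a poly set)"
    by (auto simp: monics_def small_polys_def)
  ultimately have "card ((UNIV - {0 :: 'a}) \<times> (monics d :: 'a poly set)) \<le> card (small_polys d - {0} :: 'a poly set)"
    by (intro card_inj_on_le) auto
  also have "\<dots> = CARD('a) ^ d - 1"
    using card_small_polys[of d, where ?'a = 'a] by (subst card_Diff_singleton) (auto simp: small_polys_def)
  finally have "(CARD('a) - 1) * card (monics d :: 'a poly set) \<le> CARD('a) ^ d - 1"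
    by (simp add: card_cartesian_product)
  moreover have "CARD('a) ^ d > 0" by simp
  ultimately show ?thesis by linarith
qed

lemma degree_carlitz_exp: "degree (carlitz_exp d :: 'a::{field,finite} fls poly) \<le> CARD('a) ^ d"
proof -
  have "degree (carlitz_E d :: 'a fls poly) \<le> (\<Sum>A\<in>monics d. degree [:1, - carlitz_root (A :: 'a poly):])"
    unfolding carlitz_E_def 
    using degree_prod_sum_le[OF finite_monics, of "\<lambda>A. [:1, - carlitz_root A:]"] by (simp only: comp_def)
  also have "\<dots> \<le> (\<Sum>A\<in>(monics d :: 'a poly set). 1)"
    by (intro sum_mono) simp
  finally have 1: "degree (carlitz_E d :: 'a fls poly) \<le> card (monics d :: 'a poly set)" by simp
  have "degree (carlitz_exp d :: 'a fls poly) \<le>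
     degree [:0, 1 :: 'a fls:] + degree (pcompose (carlitz_E d) (monom (1 :: 'a fls) (CARD('a) - 1)))"
    unfolding carlitz_exp_def by (rule degree_mult_le)
  also have "\<dots> \<le> 1 + degree (carlitz_E d :: 'a fls poly) * degree (monom (1 :: 'a fls) (CARD('a) - 1))"
    by (intro add_mono degree_pcompose_le) simp
  also have "\<dots> \<le> 1 + card (monics d :: 'a poly set) * (CARD('a) - 1)"
    using 1 by (intro add_mono mult_mono degree_monom_le) auto
  also have "\<dots> \<le> CARD('a) ^ d"
    using card_monics_le[of d, where ?'a = 'a] by (simp add: mult.commute)
  finally show ?thesis .
qed

text \<open>Write A = c B with B monic. As c^(q-1) = 1, A and B have the same (q-1)-st power, and
  the factor belonging to B vanishes there.\<close>

lemma poly_to_completion_root: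
  assumes "A \<in> small_polys d"
  shows "poly (carlitz_exp d) (poly_to_completion A) = 0"
proof (cases "A = 0")
  case False
  define c where "c = lead_coeff A"
  define B where "B = smult (inverse c) A"
  have c: "c \<noteq> 0" using False by (simp add: c_def)
  have A: "A = smult c B" using c by (simp add: B_def)
  have B: "B \<in> monics d" using assms False c by (simp add: B_def monics_def small_polys_def c_def)
  have B0: "B \<noteq> 0" using B by (auto simp: monics_def)
  have "poly_to_completion A ^ (CARD('a) - 1) = poly_to_completion B ^ (CARD('a) - 1)"
    using field_power_card_minus_one[OF c]
    by (simp add: A poly_to_completion_smult power_mult_distrib flip: fls_const_power)
  hence "poly [:1, - carlitz_root B:] (poly_to_completion A ^ (CARD('a) - 1)) = 0"
    using B0 by (simp add: carlitz_root_def)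
  hence "poly (carlitz_E d) (poly_to_completion A ^ (CARD('a) - 1)) = 0"
    unfolding carlitz_E_def poly_prod using B by (intro prod_zero) auto
  thus ?thesis by (simp add: poly_carlitz_exp)
qed (simp add: poly_carlitz_exp)

lemma small_polys_closed:
  "A \<in> small_polys d \<Longrightarrow> B \<in> small_polys d \<Longrightarrow> A + B \<in> small_polys d"
  "A \<in> small_polys d \<Longrightarrow> B \<in> small_polys d \<Longrightarrow> A - B \<in> small_polys d"
  by (auto simp: small_polys_def degree_add_less degree_diff_less)

text \<open>There are q^d known zeros and the degree is at most q^d. The scalar is nonzero because
  the linear coefficient of \<open>carlitz_exp d\<close> is 1.\<close>

lemma carlitz_exp_conv_prod:
  obtains a where "a \<noteq> 0"
    "carlitz_exp d = smult a (\<Prod>A\<in>small_polys d. [:- poly_to_completion (A :: 'a::{field,finite} poly), 1:])"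
proof -
  let ?W = "poly_to_completion ` (small_polys d :: 'a poly set)"
  have inj: "inj_on poly_to_completion (small_polys d :: 'a poly set)"
    by (auto simp: inj_on_def poly_to_completion_eq_iff)
  have card: "card ?W = CARD('a) ^ d" using inj by (simp add: card_image card_small_polys)
  define a where "a = coeff (carlitz_exp d :: 'a fls poly) (card ?W)"
  have "carlitz_exp d = smult a (\<Prod>w\<in>?W. [:- w, 1:])"
    unfolding a_def using card degree_carlitz_exp poly_to_completion_root
    by (intro poly_conv_prod_roots) auto
  also have "(\<Prod>w\<in>?W. [:- w, 1:]) = (\<Prod>A\<in>small_polys d. [:- poly_to_completion (A :: 'a poly), 1:])"
    using inj by (simp add: prod.reindex)
  finally have eq: "carlitz_exp d = smult a (\<Prod>A\<in>small_polys d. [:- poly_to_completion (A :: 'a poly), 1:])" .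
  moreover have "a \<noteq> 0" using coeff_carlitz_exp_1[of d, where ?'a = 'a] eq by auto
  ultimately show ?thesis using that by blast
qed

lemma poly_carlitz_exp_translate:
  assumes B: "(B :: 'a::{field,finite} poly) \<in> small_polys d"
  shows "poly (carlitz_exp d) (x + poly_to_completion B) = poly (carlitz_exp d) x"
proof -
  obtain a where a: "a \<noteq> 0"
    "carlitz_exp d = smult a (\<Prod>A\<in>small_polys d. [:- poly_to_completion (A :: 'a poly), 1:])"
    by (rule carlitz_exp_conv_prod)
  have "(\<Prod>A\<in>small_polys d. x + poly_to_completion B - poly_to_completion A) =
      (\<Prod>A\<in>small_polys d. x - poly_to_completion (A :: 'a poly))"
    using B by (intro prod.reindex_bij_witness[of _ "\<lambda>A. A + B" "\<lambda>A. A - B"])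
      (auto simp: small_polys_closed poly_to_completion_diff poly_to_completion_add)
  thus ?thesis by (simp add: a(2) poly_prod algebra_simps)
qed

lemma poly_carlitz_exp_nonzero:
  assumes "\<And>A. A \<in> small_polys d \<Longrightarrow> x \<noteq> poly_to_completion (A :: 'a::{field,finite} poly)"
  shows "poly (carlitz_exp d) x \<noteq> 0"
proof -
  obtain a where a: "a \<noteq> 0"
    "carlitz_exp d = smult a (\<Prod>A\<in>small_polys d. [:- poly_to_completion (A :: 'a poly), 1:])"
    by (rule carlitz_exp_conv_prod)
  show ?thesis using a(1) assms by (auto simp: a(2) poly_prod)
qed

lemma poly_carlitz_exp_scale:
  "poly (carlitz_exp d) (fls_const c * x) = fls_const c * poly (carlitz_exp d) (x :: 'a::{field,finite} fls)"
proof (cases "c = 0")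
  case False
  hence "fls_const c ^ (CARD('a) - 1) = 1"
    using field_power_card_minus_one[of c] by (simp flip: fls_const_power)
  thus ?thesis by (simp add: poly_carlitz_exp power_mult_distrib)
qed (simp add: poly_carlitz_exp)

text \<open>Writing e for \<open>carlitz_exp d\<close>, this is the constant c for which e - c e^q
  vanishes at 1/T; \<open>inverse fls_X_inv\<close> is 1/T.\<close>

definition carlitz_const :: "nat \<Rightarrow> 'a::{field,finite} fls" where
  "carlitz_const d = 1 / poly (carlitz_exp d) (inverse fls_X_inv) ^ (CARD('a) - 1)"

text \<open>Both sides have degree at most q^(d+1), linear coefficient 1, and vanish at the q^(d+1)
  elements A/T with A in \<open>small_polys (Suc d)\<close>.\<close>

lemma carlitz_exp_functional_equation:
  assumes p: "prime p" and q: "CARD('a::{field,finite}) = p ^ n"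
  shows "smult (inverse fls_X_inv) (pcompose (carlitz_exp (Suc d)) [:0, fls_X_inv:]) =
    carlitz_exp d - smult (carlitz_const d) (carlitz_exp d ^ CARD('a) :: 'a fls poly)"
proof (rule poly_eqI_roots_coeff_1)
  let ?q = "CARD('a)"
  let ?T = "fls_X_inv :: 'a fls"
  let ?W = "(\<lambda>A. inverse ?T * poly_to_completion A) ` (small_polys (Suc d) :: 'a poly set)"
  have q2: "?q \<ge> 2" by (rule card_UNIV_field_ge_2)
  have char: "CHAR('a fls) = p" using CHAR_finite_field[OF p q] by simp
  show "finite ?W" by simp
  show "0 \<in> ?W" by (rule image_eqI[of _ _ 0]) (auto simp: small_polys_def)
  have "inj_on (\<lambda>A. inverse ?T * poly_to_completion A) (small_polys (Suc d) :: 'a poly set)"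
    by (auto simp: inj_on_def poly_to_completion_eq_iff)
  hence card: "card ?W = ?q ^ Suc d" by (simp add: card_image card_small_polys)
  show "degree (smult (inverse ?T) (pcompose (carlitz_exp (Suc d)) [:0, ?T:])) \<le> card ?W"
    using degree_carlitz_exp[of "Suc d", where ?'a = 'a] by (simp add: card degree_pcompose)
  have "degree (carlitz_exp d ^ ?q :: 'a fls poly) \<le> ?q ^ d * ?q"
    using degree_carlitz_exp[of d, where ?'a = 'a] degree_power_le[of "carlitz_exp d :: 'a fls poly" ?q]
    by (meson le_trans mult_le_mono1)
  moreover have "?q ^ d \<le> ?q ^ d * ?q" by simp
  ultimately show "degree (carlitz_exp d - smult (carlitz_const d) (carlitz_exp d ^ ?q :: 'a fls poly)) \<le> card ?W"
    unfolding card using degree_carlitz_exp[of d, where ?'a = 'a]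
    by (intro degree_diff_le) (auto simp: mult.commute intro: le_trans degree_smult_le)
  show "coeff (smult (inverse ?T) (pcompose (carlitz_exp (Suc d)) [:0, ?T:])) 1 =
      coeff (carlitz_exp d - smult (carlitz_const d) (carlitz_exp d ^ ?q :: 'a fls poly)) 1"
    using q2 p q char
    by (simp add: coeff_pcompose_linear coeff_carlitz_exp_1[simplified] coeff_power_CHAR_power[where n = n])
next
  let ?T = "fls_X_inv :: 'a fls"
  fix w assume "w \<in> (\<lambda>A. inverse ?T * poly_to_completion A) ` (small_polys (Suc d) :: 'a poly set)"
  then obtain A where A: "A \<in> small_polys (Suc d)" and w: "w = inverse ?T * poly_to_completion A" by blast
  show "poly (smult (inverse ?T) (pcompose (carlitz_exp (Suc d)) [:0, ?T:])) w = 0"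
  proof -
    have "w * ?T = poly_to_completion A" by (simp add: w)
    thus ?thesis using poly_to_completion_root[OF A] by (simp add: poly_pcompose)
  qed
  obtain c B where B: "B \<in> small_polys d" "A = pCons c B"
    using A unfolding small_polys_Suc by auto
  have "w = inverse ?T * fls_const c + (inverse ?T * ?T) * poly_to_completion B"
    by (simp only: w B poly_to_completion_pCons distrib_left mult.assoc)
  \<comment> \<open>Up to a zero of \<open>carlitz_exp d\<close>, by which one may translate, w is a
    constant multiple of 1/T.\<close>
  hence w': "w = fls_const c * inverse ?T + poly_to_completion B" by (simp add: mult.commute)
  let ?x = "poly (carlitz_exp d) (inverse ?T)"
  have "?x \<noteq> 0"
  proof (rule poly_carlitz_exp_nonzero)
    fix A :: "'a poly"
    have "inverse ?T $$ 1 = 1" by (simp flip: fls_inverse_X)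
    thus "inverse ?T \<noteq> poly_to_completion A" by (auto simp: poly_to_completion_nth)
  qed
  \<comment> \<open>As c^q = c, the value of the right-hand side at w is c times its value at
    1/T.\<close>
  moreover have "fls_const c ^ CARD('a) = fls_const c"
    using field_power_card_minus_one[of c] power_Suc[of c "CARD('a) - 1"]
    by (cases "c = 0") (simp_all add: fls_const_power[symmetric])
  moreover have "CARD('a) = Suc (CARD('a) - 1)" by simp
  hence "?x ^ CARD('a) = ?x * ?x ^ (CARD('a) - 1)" by (metis power_Suc)
  ultimately show "poly (carlitz_exp d - smult (carlitz_const d) (carlitz_exp d ^ CARD('a))) w = 0"
    unfolding w' by (simp add: poly_carlitz_exp_translate[OF B(1)] poly_carlitz_exp_scale
      carlitz_const_def power_mult_distrib)
qed

lemma carlitz_exp_coeff_recursion: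
  assumes p: "prime p" and q: "CARD('a::{field,finite}) = p ^ n"
  shows "fls_X_inv ^ i * coeff (carlitz_exp (Suc d)) i = fls_X_inv * (coeff (carlitz_exp d) i -
    carlitz_const d * (if CARD('a) dvd i then coeff (carlitz_exp d :: 'a fls poly) (i div CARD('a)) ^ CARD('a) else 0))"
proof -
  have char: "CHAR('a fls) = p" using CHAR_finite_field[OF p q] by simp
  have "coeff (smult (inverse fls_X_inv) (pcompose (carlitz_exp (Suc d)) [:0, fls_X_inv:])) i =
    coeff (carlitz_exp d) i - carlitz_const d *
      (if CARD('a) dvd i then coeff (carlitz_exp d :: 'a fls poly) (i div CARD('a)) ^ CARD('a) else 0)"
    unfolding carlitz_exp_functional_equation[OF p q] using p q char
    by (simp add: coeff_power_CHAR_power[where n = n])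
  hence "fls_X_inv * (inverse fls_X_inv * (fls_X_inv ^ i * coeff (carlitz_exp (Suc d)) i)) = fls_X_inv * (coeff (carlitz_exp d) i -
    carlitz_const d * (if CARD('a) dvd i then coeff (carlitz_exp d :: 'a fls poly) (i div CARD('a)) ^ CARD('a) else 0))"
    by (simp add: coeff_pcompose_linear)
  thus ?thesis by (simp add: mult.assoc[symmetric])
qed

section \<open>Valuations of the coefficients of the Carlitz polynomials\<close>

lemma val_ge_carlitz_root:
  assumes "A \<noteq> 0"
  shows "val_ge (int (degree A)) (carlitz_root (A :: 'a::{field,finite} poly))"
proof -
  have "val_ge (0 - fls_subdegree (poly_to_completion A ^ (CARD('a) - 1))) (carlitz_root A)"
    unfolding carlitz_root_def using assms by (intro val_ge_divide) auto
  moreover have "int (CARD('a) - 1) * int (degree A) \<ge> 1 * int (degree A)"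
    using card_UNIV_field_ge_2[where ?'a = 'a] by (intro mult_right_mono) auto
  ultimately show ?thesis using assms
    by (elim val_ge_mono) (simp add: fls_subdegree_pow fls_subdegree_poly_to_completion)
qed

lemma val_ge_coeff_mult:
  assumes "\<And>i. val_ge N (coeff f i)" "\<And>i. val_ge M (coeff g i)"
  shows "val_ge (N + M) (coeff (f * g) i)"
  unfolding coeff_mult using assms by (intro val_ge_sum val_ge_mult)

lemma val_ge_coeff_prod_linear:
  assumes "finite S" "\<And>A. A \<in> S \<Longrightarrow> val_ge (int d) (y A)"
  shows "val_ge (int d) (coeff ((\<Prod>A\<in>S. [:1, - y A:]) - 1) i)"
  using assms
proof (induction S arbitrary: i rule: finite_induct)
  case (insert A S)
  let ?H = "\<Prod>A\<in>S. [:1, - y A:]"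
  have IH: "val_ge (int d) (coeff (?H - 1) i)" for i using insert by blast
  have H: "val_ge 0 (coeff ?H i)" for i
  proof -
    have "val_ge 0 (coeff (?H - 1) i + coeff 1 i)"
      using val_ge_mono[OF IH] by (intro val_ge_add) (auto simp: coeff_1)
    thus ?thesis by simp
  qed
  have "(\<Prod>A\<in>insert A S. [:1, - y A:]) - 1 = (?H - 1) + [:0, - y A:] * ?H"
    using insert by (simp add: algebra_simps flip: one_pCons)
  moreover have "val_ge (int d + 0) (coeff ([:0, - y A:] * ?H) i)"
    using insert H by (intro val_ge_coeff_mult) (auto simp: coeff_pCons val_ge_uminus split: nat.splits)
  ultimately show ?case using val_ge_add[OF IH] by (simp only: coeff_add add_0_right)
qed simp

lemma val_ge_coeff_carlitz_E: "val_ge 0 (coeff (carlitz_E d) i)"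
proof -
  have "val_ge (int 0) (coeff ((\<Prod>A\<in>monics d. [:1, - carlitz_root A:]) - 1) i)"
    by (rule val_ge_coeff_prod_linear[OF finite_monics])
      (auto simp: monics_def intro!: val_ge_mono[OF val_ge_carlitz_root])
  hence "val_ge 0 (coeff (carlitz_E d - 1) i + coeff 1 i)"
    by (intro val_ge_add) (auto simp: carlitz_E_def coeff_1)
  thus ?thesis by simp
qed

text \<open>The new factors belong to monics of degree exactly \<open>d\<close>, so their product is
  congruent to 1 up to valuation \<open>d\<close>.\<close>

lemma val_ge_coeff_carlitz_E_Suc:
  "val_ge (int d) (coeff (carlitz_E (Suc d)) i - coeff (carlitz_E d :: 'a::{field,finite} fls poly) i)"
proof -
  let ?S = "monics (Suc d) - monics d :: 'a poly set"
  let ?H = "\<Prod>A\<in>?S. [:1, - carlitz_root A:]"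
  have "carlitz_E (Suc d) = carlitz_E d * ?H"
    unfolding carlitz_E_def
    by (subst prod.union_disjoint[OF finite_monics finite_Diff[OF finite_monics], symmetric])
      (auto simp: monics_def intro!: prod.cong)
  hence eq: "carlitz_E (Suc d) - carlitz_E d = carlitz_E d * (?H - 1)" by (simp add: algebra_simps)
  have "val_ge (int d) (coeff (?H - 1) i)" for i
    by (rule val_ge_coeff_prod_linear[OF finite_Diff[OF finite_monics]])
      (auto simp: monics_def less_Suc_eq intro!: val_ge_mono[OF val_ge_carlitz_root])
  hence "val_ge (0 + int d) (coeff (carlitz_E d * (?H - 1)) i)"
    by (intro val_ge_coeff_mult val_ge_coeff_carlitz_E)
  thus ?thesis by (simp flip: eq coeff_diff)
qed

lemma root_prod_carlitz_root:
  assumes "distinct L" "set L = monics d"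
  shows "root_prod (map carlitz_root L) = fps_of_poly (carlitz_E d)"
proof -
  have "root_prod (map carlitz_root L) = fps_of_poly (\<Prod>A\<leftarrow>L. [:1, - carlitz_root A:])"
    by (induction L) (auto simp: root_prod_def fps_of_poly_mult fps_of_poly_pCons
      simp flip: fps_const_neg)
  also have "(\<Prod>A\<leftarrow>L. [:1, - carlitz_root A:]) = carlitz_E d"
    unfolding carlitz_E_def using assms by (metis prod.distinct_set_conv_list)
  finally show ?thesis .
qed

section \<open>Homogeneous sequences\<close>

definition null_seq :: "(nat \<Rightarrow> 'a::field fls) \<Rightarrow> bool" where
  "null_seq X \<longleftrightarrow> (\<forall>N. \<forall>\<^sub>F d in sequentially. val_ge N (X d))"

definition bounded_seq :: "(nat \<Rightarrow> 'a::field fls) \<Rightarrow> bool" where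
  "bounded_seq X \<longleftrightarrow> (\<exists>N. \<forall>\<^sub>F d in sequentially. val_ge N (X d))"

lemma null_seq_0 [simp]: "null_seq (\<lambda>_. 0)"
  by (simp add: null_seq_def)

lemma null_seq_add:
  assumes "null_seq X" "null_seq Y"
  shows "null_seq (\<lambda>d. X d + Y d)"
  unfolding null_seq_def
proof
  fix N
  have "\<forall>\<^sub>F d in sequentially. val_ge N (X d)" "\<forall>\<^sub>F d in sequentially. val_ge N (Y d)"
    using assms by (auto simp: null_seq_def)
  thus "\<forall>\<^sub>F d in sequentially. val_ge N (X d + Y d)"
    by eventually_elim (rule val_ge_add)
qed

lemma null_seq_diff:
  assumes "null_seq X" "null_seq Y"
  shows "null_seq (\<lambda>d. X d - Y d)"
  unfolding null_seq_def
proof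
  fix N
  have "\<forall>\<^sub>F d in sequentially. val_ge N (X d)" "\<forall>\<^sub>F d in sequentially. val_ge N (Y d)"
    using assms by (auto simp: null_seq_def)
  thus "\<forall>\<^sub>F d in sequentially. val_ge N (X d - Y d)"
    by eventually_elim (rule val_ge_diff)
qed

lemma null_seq_mult:
  assumes "null_seq X" "bounded_seq Y"
  shows "null_seq (\<lambda>d. X d * Y d)"
  unfolding null_seq_def
proof
  fix N
  obtain M where M: "\<forall>\<^sub>F d in sequentially. val_ge M (Y d)" using assms(2) by (auto simp: bounded_seq_def)
  have "\<forall>\<^sub>F d in sequentially. val_ge (N - M) (X d)" using assms(1) by (auto simp: null_seq_def)
  with M show "\<forall>\<^sub>F d in sequentially. val_ge N (X d * Y d)"
    by eventually_elim (use val_ge_mult in fastforce)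
qed

lemma bounded_seq_const [simp]: "bounded_seq (\<lambda>_. x)"
  unfolding bounded_seq_def by (rule exI[of _ "fls_subdegree x"]) (simp add: val_ge_conv_subdegree)

lemma bounded_seq_add:
  assumes "bounded_seq X" "bounded_seq Y"
  shows "bounded_seq (\<lambda>d. X d + Y d)"
proof -
  obtain M N where "\<forall>\<^sub>F d in sequentially. val_ge M (X d)" "\<forall>\<^sub>F d in sequentially. val_ge N (Y d)"
    using assms by (auto simp: bounded_seq_def)
  hence "\<forall>\<^sub>F d in sequentially. val_ge (min M N) (X d + Y d)"
    by eventually_elim (rule val_ge_add; erule val_ge_mono; simp)
  thus ?thesis by (auto simp: bounded_seq_def)
qed

lemma bounded_seq_mult:
  assumes "bounded_seq X" "bounded_seq Y"
  shows "bounded_seq (\<lambda>d. X d * Y d)"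
proof -
  obtain M N where "\<forall>\<^sub>F d in sequentially. val_ge M (X d)" "\<forall>\<^sub>F d in sequentially. val_ge N (Y d)"
    using assms by (auto simp: bounded_seq_def)
  hence "\<forall>\<^sub>F d in sequentially. val_ge (M + N) (X d * Y d)"
    by eventually_elim (rule val_ge_mult)
  thus ?thesis by (auto simp: bounded_seq_def)
qed

lemma bounded_seq_power: "bounded_seq X \<Longrightarrow> bounded_seq (\<lambda>d. X d ^ n)"
  by (induction n) (auto intro: bounded_seq_mult)

lemma null_seq_imp_bounded: "null_seq X \<Longrightarrow> bounded_seq X"
  by (auto simp: null_seq_def bounded_seq_def)

text \<open>
  \<open>X\<close> behaves like a rational multiple of the \<open>m\<close>-th power of the sequence \<open>c\<close>; this avoids forming
  the limit of \<open>c\<close>.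
\<close>

definition graded_seq :: "(nat \<Rightarrow> 'a::field fls) \<Rightarrow> nat \<Rightarrow> (nat \<Rightarrow> 'a fls) \<Rightarrow> bool" where
  "graded_seq c m X \<longleftrightarrow> (\<exists>r\<in>rational_functions. null_seq (\<lambda>d. X d - r * c d ^ m))"

lemma graded_seq_0: "graded_seq c m (\<lambda>_. 0)"
  unfolding graded_seq_def by (rule bexI[of _ 0]) auto

lemma graded_seq_const: "r \<in> rational_functions \<Longrightarrow> graded_seq c 0 (\<lambda>_. r)"
  unfolding graded_seq_def by (rule bexI[of _ r]) auto

lemma graded_seq_null: "null_seq X \<Longrightarrow> graded_seq c m X"
  unfolding graded_seq_def by (rule bexI[of _ 0]) auto

lemma graded_seq_base: "graded_seq c 1 c"
  unfolding graded_seq_def by (rule bexI[of _ 1]) auto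

lemma graded_seq_add:
  assumes "graded_seq c m X" "graded_seq c m Y"
  shows "graded_seq c m (\<lambda>d. X d + Y d)"
proof -
  obtain r s where rs: "r \<in> rational_functions" "s \<in> rational_functions"
    "null_seq (\<lambda>d. X d - r * c d ^ m)" "null_seq (\<lambda>d. Y d - s * c d ^ m)"
    using assms by (auto simp: graded_seq_def)
  have "(\<lambda>d. X d + Y d - (r + s) * c d ^ m) = (\<lambda>d. (X d - r * c d ^ m) + (Y d - s * c d ^ m))"
    by (simp add: fun_eq_iff algebra_simps)
  thus ?thesis unfolding graded_seq_def using rs null_seq_add[OF rs(3,4)]
    by (intro bexI[of _ "r + s"]) auto
qed

lemma graded_seq_sum:
  "(\<And>i. i \<in> A \<Longrightarrow> graded_seq c m (X i)) \<Longrightarrow> graded_seq c m (\<lambda>d. \<Sum>i\<in>A. X i d)"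
  by (induction A rule: infinite_finite_induct) (auto intro: graded_seq_0 graded_seq_add)

context
  fixes c :: "nat \<Rightarrow> 'a::field fls"
  assumes c: "bounded_seq c"
begin

text \<open>X Y - r s c^(m+n) = (X - r c^m) Y + (Y - s c^n) r c^m, where boundedness of c makes Y
  bounded.\<close>

lemma graded_seq_mult:
  assumes "graded_seq c m X" "graded_seq c n Y"
  shows "graded_seq c (m + n) (\<lambda>d. X d * Y d)"
proof -
  obtain r s where rs: "r \<in> rational_functions" "s \<in> rational_functions"
    "null_seq (\<lambda>d. X d - r * c d ^ m)" "null_seq (\<lambda>d. Y d - s * c d ^ n)"
    using assms by (auto simp: graded_seq_def)
  have bounded: "bounded_seq (\<lambda>d. r * c d ^ m)" "bounded_seq (\<lambda>d. s * c d ^ n)"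
    by (intro bounded_seq_mult bounded_seq_power bounded_seq_const c)+
  have "bounded_seq Y"
    using bounded_seq_add[OF null_seq_imp_bounded[OF rs(4)] bounded(2)] by simp
  hence "null_seq (\<lambda>d. (X d - r * c d ^ m) * Y d + (Y d - s * c d ^ n) * (r * c d ^ m))"
    using rs bounded by (intro null_seq_add null_seq_mult)
  moreover have "(\<lambda>d. (X d - r * c d ^ m) * Y d + (Y d - s * c d ^ n) * (r * c d ^ m)) =
      (\<lambda>d. X d * Y d - (r * s) * c d ^ (m + n))"
    by (simp add: fun_eq_iff algebra_simps power_add)
  ultimately show ?thesis unfolding graded_seq_def using rs by (intro bexI[of _ "r * s"]) auto
qed

lemma graded_seq_const_mult:
  "r \<in> rational_functions \<Longrightarrow> graded_seq c m X \<Longrightarrow> graded_seq c m (\<lambda>d. r * X d)"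
  using graded_seq_mult[OF graded_seq_const, of r m X] by simp

lemma graded_seq_diff:
  assumes "graded_seq c m X" "graded_seq c m Y"
  shows "graded_seq c m (\<lambda>d. X d - Y d)"
  using graded_seq_add[OF assms(1) graded_seq_const_mult[OF _ assms(2), of "- 1"]]
  by (simp add: rational_functions_uminus)

lemma graded_seq_power: "graded_seq c m X \<Longrightarrow> graded_seq c (m * n) (\<lambda>d. X d ^ n)"
  by (induction n) (auto intro: graded_seq_const graded_seq_mult)

lemma graded_seq_carry:
  assumes "graded_seq c k X" "graded_seq c k Y"
  shows "graded_seq c (p * k) (\<lambda>d. carry p (X d) (Y d))"
  unfolding carry_def
proof (rule graded_seq_sum)
  fix i assume "i \<in> {0<..<p}"
  hence "k * i + k * (p - i) = p * k" by (simp add: algebra_simps flip: distrib_left)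
  moreover have "graded_seq c (0 + k * i + k * (p - i)) (\<lambda>d. of_nat ((p choose i) div p) * X d ^ i * Y d ^ (p - i))"
    using assms by (intro graded_seq_mult graded_seq_power graded_seq_const) auto
  ultimately show "graded_seq c (p * k) (\<lambda>d. of_nat ((p choose i) div p) * X d ^ i * Y d ^ (p - i))"
    by simp
qed

lemma graded_seq_sum_list:
  "(\<And>X. X \<in> set Xs \<Longrightarrow> graded_seq c k X) \<Longrightarrow> graded_seq c k (\<lambda>d. \<Sum>X\<leftarrow>Xs. X d)"
  by (induction Xs) (auto intro: graded_seq_0 graded_seq_add)

lemma graded_seq_fermat:
  "(\<And>X. X \<in> set Xs \<Longrightarrow> graded_seq c k X) \<Longrightarrow>
    graded_seq c (p * k) (\<lambda>d. fermat p (map (\<lambda>X. X d) Xs))"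
proof (induction Xs)
  case (Cons X Xs)
  have "graded_seq c (p * k) (\<lambda>d. fermat p (map (\<lambda>X. X d) Xs) + carry p (X d) (\<Sum>X\<leftarrow>Xs. X d))"
    by (intro graded_seq_add Cons.IH graded_seq_carry graded_seq_sum_list Cons.prems) auto
  thus ?case by simp
qed (simp add: graded_seq_0)

text \<open>The weight \<open>i\<close> does not depend on \<open>n\<close>: the factor of exponent
  n + 1 lowers the index by n + 1 and supplies a coordinate of weight n + 1.\<close>

lemma graded_seq_witt_prod:
  assumes "\<And>m. graded_seq c m (\<lambda>d. fps_nth (E d) m)"
  shows "graded_seq c i (\<lambda>d. fps_nth (witt_prod (E d) n) i)"
proof (induction n arbitrary: i)
  case 0
  show ?case by (cases "i = 0") (auto intro: graded_seq_const graded_seq_0)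
next
  case (Suc n)
  have "graded_seq c (Suc n) (\<lambda>d. fps_nth (witt_prod (E d) n) (Suc n) - fps_nth (E d) (Suc n))"
    by (intro graded_seq_diff Suc.IH assms)
  hence *: "graded_seq c (i - Suc n + Suc n) (\<lambda>d. fps_nth (witt_prod (E d) n) (i - Suc n) *
      (fps_nth (witt_prod (E d) n) (Suc n) - fps_nth (E d) (Suc n)))"
    by (intro graded_seq_mult Suc.IH)
  show ?case
  proof (cases "i < Suc n")
    case True
    thus ?thesis using Suc.IH by (simp add: fps_mult_one_minus_monom_nth del: power_Suc)
  next
    case False
    hence "i - Suc n + Suc n = i" by simp
    with * Suc.IH False show ?thesis
      by (simp add: fps_mult_one_minus_monom_nth graded_seq_diff del: power_Suc)
  qed
qed

lemma graded_seq_witt_coord: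
  assumes "\<And>m. graded_seq c m (\<lambda>d. fps_nth (E d) m)"
  shows "graded_seq c n (\<lambda>d. witt_coord (E d) n)"
  unfolding witt_coord_def by (intro graded_seq_diff graded_seq_witt_prod assms)

lemma graded_seq_witt_coord_power:
  assumes "\<And>m. graded_seq c m (\<lambda>d. fps_nth (E d) m)" "m dvd k"
  shows "graded_seq c k (\<lambda>d. witt_coord (E d) m ^ (k div m))"
  using graded_seq_power[OF graded_seq_witt_coord[OF assms(1)], of m "k div m"] assms(2) by simp

lemma graded_seq_power_sum:
  assumes "\<And>m. graded_seq c m (\<lambda>d. fps_nth (root_prod (ys d)) m)" "k > 0"
  shows "graded_seq c k (\<lambda>d. \<Sum>y\<leftarrow>ys d. y ^ k)"
  unfolding power_sum_conv_witt_coord[OF assms(2)]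
  by (intro graded_seq_sum graded_seq_const_mult graded_seq_witt_coord_power assms) auto

lemma graded_seq_fermat_powers:
  assumes "\<And>m. graded_seq c m (\<lambda>d. fps_nth (root_prod (ys d)) m)" "k > 0" "prime p"
  shows "graded_seq c (p * k) (\<lambda>d. fermat p (map (\<lambda>y. y ^ k) (ys d)))"
proof -
  \<comment> \<open>The entries of \<open>witt_list\<close> as sequences in d. The length of the
    list does not depend on d, although that of \<open>ys d\<close> may.\<close>
  define Xs where "Xs = concat (map (\<lambda>m. replicate m (\<lambda>d. witt_coord (root_prod (ys d)) m ^ (k div m)))
     (filter (\<lambda>m. m dvd k) [1..<Suc k]))"
  have eq: "witt_list (root_prod (ys d)) k = map (\<lambda>X. X d) Xs" for d
    by (simp add: witt_list_def Xs_def map_concat comp_def del: upt_Suc)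
  have "graded_seq c k X" if "X \<in> set Xs" for X
    using that graded_seq_witt_coord_power[OF assms(1)] by (auto simp: Xs_def)
  thus ?thesis unfolding fermat_powers[OF assms(3,2)] eq
    by (intro graded_seq_diff graded_seq_fermat graded_seq_sum graded_seq_const_mult
      graded_seq_witt_coord_power assms) auto
qed

end

section \<open>Weights of the coefficients of the Carlitz polynomials\<close>

lemma bounded_seq_coeff_carlitz_E: "bounded_seq (\<lambda>d. coeff (carlitz_E (f d)) m)"
  unfolding bounded_seq_def by (intro exI[of _ 0] always_eventually allI val_ge_coeff_carlitz_E)

lemma null_seq_coeff_carlitz_E:
  "null_seq (\<lambda>d. coeff (carlitz_E (Suc d)) m - coeff (carlitz_E d :: 'a::{field,finite} fls poly) m)"
  unfolding null_seq_def
proof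
  fix N
  have "\<forall>\<^sub>F d in sequentially. d \<ge> nat N" by (rule eventually_ge_at_top)
  thus "\<forall>\<^sub>F d in sequentially. val_ge N (coeff (carlitz_E (Suc d)) m - coeff (carlitz_E d :: 'a fls poly) m)"
    by eventually_elim (rule val_ge_mono[OF val_ge_coeff_carlitz_E_Suc], simp)
qed

context
  fixes p n :: nat
  assumes p: "prime p" and q: "CARD('a::{field,finite}) = p ^ n"
begin

lemma coeff_carlitz_E_recursion:
  assumes "i = Suc ((CARD('a) - 1) * m)"
  shows "fls_X_inv ^ i * coeff (carlitz_E (Suc d)) m = fls_X_inv * (coeff (carlitz_E d) m -
    carlitz_const d * (if CARD('a) dvd i then coeff (carlitz_exp d :: 'a fls poly) (i div CARD('a)) ^ CARD('a) else 0))"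
proof -
  have "coeff (carlitz_exp d :: 'a fls poly) i = coeff (carlitz_E d) m" for d
    unfolding assms by (rule coeff_carlitz_exp)
  thus ?thesis using carlitz_exp_coeff_recursion[OF p q, of i d] by simp
qed

text \<open>For m = 1 the index i is q, and the q-th power in the recursion is that of the linear
  coefficient 1. The recursion can thus be solved for the constant in terms of bounded
  coefficients.\<close>

lemma bounded_seq_carlitz_const: "bounded_seq (carlitz_const :: nat \<Rightarrow> 'a fls)"
proof -
  let ?T = "fls_X_inv :: 'a fls"
  have "Suc ((CARD('a) - 1) * 1) = CARD('a)" by simp
  note * = coeff_carlitz_E_recursion[OF this[symmetric]]
  have "carlitz_const d = coeff (carlitz_E d) 1 + - inverse ?T * (?T ^ CARD('a) * coeff (carlitz_E (Suc d)) 1)" for d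
    unfolding * by (simp add: coeff_carlitz_exp_1[simplified] mult.assoc[symmetric])
  moreover have "bounded_seq (\<lambda>d. coeff (carlitz_E d) 1 + - inverse ?T * (?T ^ CARD('a) * coeff (carlitz_E (Suc d)) 1))"
    by (intro bounded_seq_add bounded_seq_mult bounded_seq_const bounded_seq_coeff_carlitz_E)
  ultimately show ?thesis by presburger
qed

lemma fls_X_inv_power_diff_nonzero:
  assumes "i \<ge> 2"
  shows "fls_X_inv ^ i - fls_X_inv \<noteq> (0 :: 'a fls)"
proof
  assume "fls_X_inv ^ i - fls_X_inv = (0 :: 'a fls)"
  hence "fls_subdegree (fls_X_inv ^ i :: 'a fls) = fls_subdegree (fls_X_inv :: 'a fls)" by simp
  thus False using assms by (simp add: fls_subdegree_pow)
qed

text \<open>Replacing d + 1 by d in the recursion costs a null sequence and leaves a linear equation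
  for the coefficient with leading factor T^i - T, a nonzero rational function. The other term is
  the constant times the q-th power of a coefficient of smaller index, or 0.\<close>

lemma graded_seq_coeff_carlitz_E:
  "graded_seq carlitz_const m (\<lambda>d. coeff (carlitz_E d :: 'a fls poly) m)"
proof (induction m rule: less_induct)
  case (less m)
  let ?q = "CARD('a)" and ?T = "fls_X_inv :: 'a fls" and ?c = "carlitz_const :: nat \<Rightarrow> 'a fls"
  note bnd = bounded_seq_carlitz_const
  have q2: "?q \<ge> 2" by (rule card_UNIV_field_ge_2)
  show ?case
  proof (cases "m = 0")
    case True
    thus ?thesis by (simp add: coeff_carlitz_E_0 graded_seq_const)
  next
    case False
    define i where "i = Suc ((?q - 1) * m)"
    have i2: "i \<ge> 2" using False q2 by (simp add: i_def)
    define D where "D = (\<lambda>d. coeff (carlitz_E (Suc d)) m - coeff (carlitz_E d :: 'a fls poly) m)"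
    define X where "X = (\<lambda>d. if ?q dvd i then coeff (carlitz_exp d :: 'a fls poly) (i div ?q) ^ ?q else 0)"
    have D: "null_seq D" unfolding D_def by (rule null_seq_coeff_carlitz_E)
    let ?r = "?T / (?T ^ i - ?T)" and ?s = "?T ^ i / (?T ^ i - ?T)"
    have "coeff (carlitz_E d) m = - ?r * (?c d * X d) - ?s * D d" for d
    proof -
      have "(?T ^ i - ?T) * coeff (carlitz_E d) m = - ?T * (?c d * X d) - ?T ^ i * D d"
        using coeff_carlitz_E_recursion[OF i_def, of d] by (simp add: D_def X_def algebra_simps)
      hence "coeff (carlitz_E d) m = (- ?T * (?c d * X d) - ?T ^ i * D d) / (?T ^ i - ?T)"
        using fls_X_inv_power_diff_nonzero[OF i2] by (simp add: nonzero_eq_divide_eq mult.commute)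
      thus ?thesis by (simp add: diff_divide_distrib)
    qed
    moreover have "graded_seq ?c m (\<lambda>d. ?c d * X d)"
    proof (cases "?q dvd i")
      case True
      then obtain l where l: "i = ?q * l" ..
      have "l > 0" using l i2 by (intro Nat.gr0I) auto
      then obtain l' where l': "l = Suc l'" by (metis gr0_conv_Suc)
      \<comment> \<open>Write \<open>i = q (1 + (q - 1) m')\<close>; then \<open>m = 1 + q m'\<close>.\<close>
      have ex: "\<exists>m'. l' = (?q - 1) * m'"
      proof -
        obtain r where r: "?q = Suc r" using q2 by (cases "?q") auto
        have "r * m = r + l' * Suc r" using l by (simp add: i_def l' r)
        hence "r dvd r + (l' * r + l')" by (metis dvd_triv_left mult_Suc_right add.commute)
        hence "r dvd l'" by (simp add: dvd_add_right_iff)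
        thus ?thesis using r by auto
      qed
      then obtain m' where m': "l' = (?q - 1) * m'" ..
      have "(?q - 1) * m = (?q - 1) * (1 + m' * ?q)"
      proof -
        obtain r where r: "?q = Suc r" using q2 by (cases "?q") auto
        show ?thesis using l by (simp add: i_def l' m' r algebra_simps)
      qed
      moreover have "0 < ?q - 1" using q2 by simp
      ultimately have m: "m = 1 + m' * ?q" by (metis nat_mult_eq_cancel1)
      have "m' < m" using q2 by (simp add: m less_Suc_eq_le)
      \<comment> \<open>The constant has weight 1 and the q-th power has weight q m', which add up
        to m.\<close>
      have "graded_seq ?c (1 + m' * ?q) (\<lambda>d. ?c d * coeff (carlitz_E d) m' ^ ?q)"
        by (intro graded_seq_mult graded_seq_power bnd graded_seq_base less.IH \<open>m' < m\<close>)
      moreover have "coeff (carlitz_exp d :: 'a fls poly) l = coeff (carlitz_E d) m'" for d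
        by (simp only: l' m' coeff_carlitz_exp)
      hence "X = (\<lambda>d. coeff (carlitz_E d) m' ^ ?q)" using l by (simp add: X_def)
      ultimately show ?thesis by (simp only: m)
    qed (simp add: X_def graded_seq_0)
    moreover have "graded_seq ?c m (\<lambda>d. - ?r * (?c d * X d) - ?s * D d)"
      if "graded_seq ?c m (\<lambda>d. ?c d * X d)"
      by (intro graded_seq_diff graded_seq_const_mult bnd graded_seq_null[OF D] that
        rational_functions_uminus rational_functions_divide rational_functions_diff
        rational_functions_power fls_X_inv_in_rational_functions)
    ultimately show ?thesis by simp
  qed
qed

end

section \<open>Rationality of the limit and convergence of the sum over primes\<close>

lemma val_ge_inverse_power:
  assumes "lead_coeff A = 1" "k > 0"
  shows "val_ge (int (degree A)) (1 / poly_to_completion A ^ k)"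
proof -
  have A: "A \<noteq> 0" using assms by auto
  have "val_ge (0 - fls_subdegree (poly_to_completion A ^ k)) (1 / poly_to_completion A ^ k)"
    using A by (intro val_ge_divide) auto
  moreover have "int k * int (degree A) \<ge> 1 * int (degree A)"
    using assms by (intro mult_right_mono) auto
  ultimately show ?thesis using A
    by (elim val_ge_mono) (simp add: fls_subdegree_pow fls_subdegree_poly_to_completion)
qed

text \<open>If M is close to r c^w and s to r' c^w, the combination M r' - s r cancels c^w and tends
  to 0, so M / s tends to r / r'. Here r' is nonzero, as otherwise s would tend to 0 although it
  stays congruent to 1.\<close>

lemma null_seq_quotient:
  fixes M s :: "nat \<Rightarrow> 'a::field fls"
  assumes "bounded_seq c" "graded_seq c w M" "graded_seq c w s" "\<forall>\<^sub>F d in sequentially. val_ge 1 (s d - 1)"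
  shows "\<exists>r\<in>rational_functions. null_seq (\<lambda>d. M d / s d - r)"
proof -
  obtain r r' where r: "r \<in> rational_functions" "null_seq (\<lambda>d. M d - r * c d ^ w)"
    "r' \<in> rational_functions" "null_seq (\<lambda>d. s d - r' * c d ^ w)"
    using assms(2,3) by (auto simp: graded_seq_def)
  have "r' \<noteq> 0"
  proof
    assume "r' = 0"
    with r(4) have "\<forall>\<^sub>F d in sequentially. val_ge 1 (s d)" by (simp add: null_seq_def)
    with assms(4) have "\<forall>\<^sub>F d in sequentially. False"
    proof eventually_elim
      case (elim d)
      hence "val_ge 1 (s d - (s d - 1))" using val_ge_diff by blast
      hence "val_ge 1 (1 :: 'a fls)" by simp
      thus False by (simp add: val_ge_conv_subdegree)
    qed
    thus False by simp
  qed
  have "null_seq (\<lambda>d. (M d - r * c d ^ w) * r' - (s d - r' * c d ^ w) * r)"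
    by (intro null_seq_diff null_seq_mult[OF r(2)] null_seq_mult[OF r(4)] bounded_seq_const)
  hence null: "null_seq (\<lambda>d. M d * r' - s d * r)" by (simp add: algebra_simps)
  have "null_seq (\<lambda>d. M d / s d - r / r')"
    unfolding null_seq_def
  proof
    fix N
    have "\<forall>\<^sub>F d in sequentially. val_ge (N + fls_subdegree r') (M d * r' - s d * r)"
      using null by (auto simp: null_seq_def)
    with assms(4) show "\<forall>\<^sub>F d in sequentially. val_ge N (M d / s d - r / r')"
    proof eventually_elim
      case (elim d)
      have "M d / s d - r / r' = (M d * r' - s d * r) / r' / s d"
        using one_unit(1)[OF elim(1)] \<open>r' \<noteq> 0\<close> by (simp add: field_simps)
      moreover have "val_ge (N + fls_subdegree r' - fls_subdegree r') ((M d * r' - s d * r) / r' / s d)"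
        using elim \<open>r' \<noteq> 0\<close> by (intro val_ge_divide_one_unit val_ge_divide)
      ultimately show ?case by simp
    qed
  qed
  thus ?thesis using r by blast
qed

theorem theorem1p4:
  fixes p q n k :: nat
  assumes "prime p" and "n > 0" and "q = p ^ n"
    and "CARD('a::{field,finite}) = q"
    and "k > 0" and "[k = 0] (mod (q - 1))"
  shows "\<exists>s \<in> rational_functions.
    ((\<lambda>P. G p (1 / poly_to_completion P ^ k)) has_sum s) (monic_irreducibles :: 'a poly set)"
proof -
  note p = \<open>prime p\<close>
  have q: "CARD('a) = p ^ n" using assms by simp
  have char: "CHAR('a) = p" by (rule CHAR_finite_field[OF p q])
  define \<chi> :: "'a poly \<Rightarrow> 'a fls" where "\<chi> = (\<lambda>A. 1 / poly_to_completion A ^ k)"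
  have \<chi>: "\<chi> 1 = 1" "\<And>A B. \<chi> (A * B) = \<chi> A * \<chi> B"
    "\<And>A. lead_coeff A = 1 \<Longrightarrow> val_ge (int (degree A)) (\<chi> A)"
    using val_ge_inverse_power[OF _ \<open>k > 0\<close>]
    by (simp_all add: \<chi>_def poly_to_completion_mult power_mult_distrib)
  \<comment> \<open>Divisibility of k by q - 1 makes A^(-k) a power of the Carlitz root of
    A.\<close>
  obtain k' where k': "k = (CARD('a) - 1) * k'"
    using assms by (auto simp: cong_0_iff)
  have "k' > 0" using k' \<open>k > 0\<close> by (intro Nat.gr0I) auto
  have \<chi>_root: "\<chi> = (\<lambda>A. carlitz_root A ^ k')"
    by (simp add: fun_eq_iff \<chi>_def carlitz_root_def k' power_mult power_one_over)
  define I where "I = (\<lambda>d. {P \<in> (monic_irreducibles :: 'a poly set). degree P < d})"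
  have finI: "finite (I d)" for d
    by (rule finite_subset[OF _ finite_monics[of d]]) (auto simp: I_def monics_def monic_irreducibles_def)
  obtain L :: "nat \<Rightarrow> 'a poly list" where L: "\<And>d. distinct (L d)" "\<And>d. set (L d) = monics d"
    using finite_distinct_list[OF finite_monics] by metis
  define M where "M = (\<lambda>d. fermat p (map \<chi> (L d)))"
  define s where "s = (\<lambda>d. \<Sum>A\<leftarrow>L d. \<chi> A ^ p)"
  have E: "graded_seq carlitz_const m (\<lambda>d. fps_nth (root_prod (map carlitz_root (L d))) m)" for m
    using graded_seq_coeff_carlitz_E[OF p q] by (simp add: root_prod_carlitz_root[OF L])
  note bnd = bounded_seq_carlitz_const[OF p q]
  \<comment> \<open>Numerator and denominator receive the same weight p k', so that their quotient
    has a rational limit.\<close>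
  have "graded_seq carlitz_const (p * k') M"
    using graded_seq_fermat_powers[OF bnd E \<open>k' > 0\<close> p] by (simp add: M_def comp_def \<chi>_root)
  moreover have "graded_seq carlitz_const (p * k') s"
    using graded_seq_power_sum[OF bnd E, of "p * k'"] \<open>k' > 0\<close> prime_gt_0_nat[OF p]
    by (simp add: s_def comp_def \<chi>_root mult.commute[of p] flip: power_mult)
  moreover have "\<forall>\<^sub>F d in sequentially. val_ge 1 (s d - 1)"
    using eventually_gt_at_top[of 0]
  proof eventually_elim
    case (elim d)
    show ?case unfolding s_def
      by (rule sum_powers_one_unit[OF \<chi> p]) (use L elim in \<open>auto simp: monics_def\<close>)
  qed
  ultimately obtain r where r: "r \<in> rational_functions" "null_seq (\<lambda>d. M d / s d - r)"
    using null_seq_quotient[OF bnd] by blast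
  have approx: "val_ge (int d) ((\<Sum>P\<in>I d. G p (\<chi> P)) - M d / s d)" if "d > 0" for d
  proof -
    obtain Ps where Ps: "distinct Ps" "set Ps = I d" using finite_distinct_list[OF finI] by metis
    show ?thesis
      using sum_G_approx[OF \<chi> p char that L Ps(1)] Ps
      by (simp add: I_def M_def s_def sum_list_distinct_conv_sum_set)
  qed
  have "((\<lambda>P. G p (\<chi> P)) has_sum r) monic_irreducibles"
    unfolding has_sum_def
  proof (rule tendstoI)
    fix e :: real assume "e > 0"
    then obtain N where N: "(1 / 2) ^ N < e" using real_arch_pow_inv[of e "1 / 2"] by auto
    have "\<forall>\<^sub>F d in sequentially. val_ge (int N) (M d / s d - r) \<and> d > N"
      using r(2) eventually_gt_at_top[of N] by (auto simp: null_seq_def intro: eventually_conj)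
    then obtain d where d: "val_ge (int N) (M d / s d - r)" "d > N"
      by (auto dest: eventually_happens)
    \<comment> \<open>One d serves for all finite F containing \<open>I d\<close>. Each remaining
      prime has degree above N and contributes a term of valuation at least N, and by the
      ultrametric inequality their number is irrelevant.\<close>
    have "dist (\<Sum>P\<in>F. G p (\<chi> P)) r < e"
      if F: "finite F" "I d \<subseteq> F" "F \<subseteq> monic_irreducibles" for F
    proof -
      have "(\<Sum>P\<in>F. G p (\<chi> P)) = (\<Sum>P\<in>I d. G p (\<chi> P)) + (\<Sum>P\<in>F - I d. G p (\<chi> P))"
        using F by (simp add: sum.subset_diff add.commute)
      hence eq: "(\<Sum>P\<in>F. G p (\<chi> P)) - r = ((\<Sum>P\<in>I d. G p (\<chi> P)) - M d / s d) +
          (M d / s d - r) + (\<Sum>P\<in>F - I d. G p (\<chi> P))" by simp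
      have "val_ge (int N) (G p (\<chi> P))" if "P \<in> F - I d" for P
      proof -
        have P: "lead_coeff P = 1" "degree P > N"
          using that F d by (auto simp: I_def monic_irreducibles_def)
        have "val_ge (int (degree P)) (G p (\<chi> P))"
          by (rule val_ge_G[OF p \<chi>(3)[OF P(1)]]) (use P in auto)
        thus ?thesis by (rule val_ge_mono) (use P in auto)
      qed
      hence "val_ge (int N) ((\<Sum>P\<in>F. G p (\<chi> P)) - r)"
        unfolding eq using d val_ge_mono[OF approx, of d "int N"]
        by (intro val_ge_add val_ge_sum) auto
      from dist_fls_le[OF this] N show ?thesis by simp
    qed
    moreover have "I d \<subseteq> monic_irreducibles" by (auto simp: I_def)
    ultimately show "\<forall>\<^sub>F F in finite_subsets_at_top monic_irreducibles. dist (\<Sum>P\<in>F. G p (\<chi> P)) r < e"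
      unfolding eventually_finite_subsets_at_top using finI by blast
  qed
  thus ?thesis using r(1) unfolding \<chi>_def by blast
qed

end
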